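(* Let $G$ be a cofinite groupoid with a finite vertex set. Then its completion $\overline G$ is a profinite groupoid (with the groupoid operations that continuously extend those of $G$) with $V(\overline G)=V(G)$. Moreover, the rigid cofinite congruences on $\overline G$ consist precisely of the closures $\overline\rho$ in $\overline G\times\overline G$ of all rigid cofinite congruences $\rho$ on $G$.
   Context: A directed graph is a set $\Gamma$ with a distinguished subset $V(\Gamma)$ and two functions $s,t\colon\Gamma\to V(\Gamma)$ with $s(x)=t(x)=x$ for $x\in V(\Gamma)$. A sub-directed graph is a subset closed under $s,t$. A topological directed graph is a directed graph with a topology making $s,t\colon\Gamma\to V(\Gamma)$ continuous. A groupoid is a directed graph $G$ with a partial binary operation such that: $gh$ is defined iff $t(g)=s(h)$, and then $s(gh)=s(g)$, $t(gh)=t(h)$; $(gh)k=g(hk)$ whenever $t(g)=s(h)$ and $t(h)=s(k)$; $s(g)g=g=gt(g)$; and each $g$ has $g^{-1}$ with $s(g^{-1})=t(g)$, $t(g^{-1})=s(g)$, $gg^{-1}=s(g)$, $g^{-1}g=t(g)$. Write $G^{(2)}=\{(g,h)\mid t(g)=s(h)\}$. Products of groupoids are taken coordinatewise. A topological groupoid has continuous source, target, inversion and partial product maps. A profinite groupoid is an inverse limit of an inverse system of finite discrete topological groupoids (and homomorphisms). A congruence on a groupoid $G$ is an equivalence relation $\rho$ on $G$ that is a subgroupoid of $G\times G$ (closed under $s$, $t$, inverses and defined products). It is rigid if $\rho\cap[V(G)\times V(G)]$ is the diagonal of $V(G)$. For a groupoid with a uniformity, a cofinite congruence is a congruence of finite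 index (finitely many classes) which is also an entourage. A cofinite groupoid is a groupoid endowed with a Hausdorff uniformity for which the set of cofinite congruences is a base. Every compact Hausdorff space is regarded as a uniform space with its unique compatible uniformity. A cofinite groupoid $G$ is in particular a cofinite directed graph (Hausdorff uniformity with a base of finite-index equivalence relations compatible with $s,t$). Its completion $\overline G$ is the compact Hausdorff topological directed graph, unique up to isomorphism of topological directed graphs extending the identity on $G$, that contains $G$ as a dense sub-directed graph whose uniformity is induced from $\overline G$. The groupoid structure on $\overline G$ is given by the unique continuous maps $\overline G\to\overline G$ and $\overline G^{(2)}\to\overline G$ extending inversion $G\to G$ and the partial product $G^{(2)}\to G$, where $\overline G^{(2)}=\{(g,h)\in\overline G\times\overline G\mid t(g)=s(h)\}$. *)

theory Defs
  imports "HOL-Analysis.Analysis"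
begin

section \<open>Directed graphs and groupoids\<close>

record 'a digraph =
  carrier :: "'a set"
  verts :: "'a set"
  src :: "'a \<Rightarrow> 'a"
  tgt :: "'a \<Rightarrow> 'a"

text \<open>The product is a total function; only its values on composable pairs are meaningful.\<close>

record 'a groupoid = "'a digraph" +
  gmult :: "'a \<Rightarrow> 'a \<Rightarrow> 'a"
  ginv :: "'a \<Rightarrow> 'a"

definition is_digraph :: "('a, 'm) digraph_scheme \<Rightarrow> bool" where
  "is_digraph \<Gamma> \<longleftrightarrow>
     verts \<Gamma> \<subseteq> carrier \<Gamma> \<and>
     src \<Gamma> \<in> carrier \<Gamma> \<rightarrow> verts \<Gamma> \<and>
     tgt \<Gamma> \<in> carrier \<Gamma> \<rightarrow> verts \<Gamma> \<and>
     (\<forall>v\<in>verts \<Gamma>. src \<Gamma> v = v \<and> tgt \<Gamma> v = v)"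

definition composable :: "('a, 'm) digraph_scheme \<Rightarrow> ('a \<times> 'a) set" where
  "composable \<Gamma> = {(g, h) \<in> carrier \<Gamma> \<times> carrier \<Gamma>. tgt \<Gamma> g = src \<Gamma> h}"

definition is_groupoid :: "'a groupoid \<Rightarrow> bool" where
  "is_groupoid G \<longleftrightarrow>
     is_digraph G \<and>
     (\<forall>(g, h)\<in>composable G. gmult G g h \<in> carrier G \<and>
        src G (gmult G g h) = src G g \<and> tgt G (gmult G g h) = tgt G h) \<and>
     (\<forall>g h k. (g, h) \<in> composable G \<longrightarrow> (h, k) \<in> composable G \<longrightarrow>
        gmult G (gmult G g h) k = gmult G g (gmult G h k)) \<and>
     (\<forall>g\<in>carrier G. gmult G (src G g) g = g \<and> gmult G g (tgt G g) = g) \<and>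
     (\<forall>g\<in>carrier G. ginv G g \<in> carrier G \<and>
        src G (ginv G g) = tgt G g \<and> tgt G (ginv G g) = src G g \<and>
        gmult G g (ginv G g) = src G g \<and> gmult G (ginv G g) g = tgt G g)"

definition prod_groupoid :: "'a groupoid \<Rightarrow> 'b groupoid \<Rightarrow> ('a \<times> 'b) groupoid" where
  "prod_groupoid G H =
     \<lparr>carrier = carrier G \<times> carrier H,
      verts = verts G \<times> verts H,
      src = (\<lambda>(g, h). (src G g, src H h)),
      tgt = (\<lambda>(g, h). (tgt G g, tgt H h)),
      gmult = (\<lambda>(g, h) (g', h'). (gmult G g g', gmult H h h')),
      ginv = (\<lambda>(g, h). (ginv G g, ginv H h))\<rparr>"

definition subgroupoid :: "'a set \<Rightarrow> 'a groupoid \<Rightarrow> bool" where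
  "subgroupoid S G \<longleftrightarrow>
     S \<subseteq> carrier G \<and>
     (\<forall>x\<in>S. src G x \<in> S \<and> tgt G x \<in> S \<and> ginv G x \<in> S) \<and>
     (\<forall>x\<in>S. \<forall>y\<in>S. (x, y) \<in> composable G \<longrightarrow> gmult G x y \<in> S)"

definition digraph_hom :: "('a, 'm) digraph_scheme \<Rightarrow> ('b, 'n) digraph_scheme \<Rightarrow> ('a \<Rightarrow> 'b) \<Rightarrow> bool"
  where
  "digraph_hom \<Gamma> \<Delta> f \<longleftrightarrow>
     f \<in> carrier \<Gamma> \<rightarrow> carrier \<Delta> \<and>
     (\<forall>x\<in>carrier \<Gamma>. f (src \<Gamma> x) = src \<Delta> (f x) \<and> f (tgt \<Gamma> x) = tgt \<Delta> (f x))"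

definition groupoid_hom :: "'a groupoid \<Rightarrow> 'b groupoid \<Rightarrow> ('a \<Rightarrow> 'b) \<Rightarrow> bool" where
  "groupoid_hom G H f \<longleftrightarrow>
     digraph_hom G H f \<and>
     (\<forall>(g, h)\<in>composable G. f (gmult G g h) = gmult H (f g) (f h))"

section \<open>Topological directed graphs and groupoids\<close>

definition topological_digraph :: "('a, 'm) digraph_scheme \<Rightarrow> 'a topology \<Rightarrow> bool" where
  "topological_digraph \<Gamma> T \<longleftrightarrow>
     is_digraph \<Gamma> \<and> topspace T = carrier \<Gamma> \<and>
     continuous_map T (subtopology T (verts \<Gamma>)) (src \<Gamma>) \<and>
     continuous_map T (subtopology T (verts \<Gamma>)) (tgt \<Gamma>)"

definition continuous_operations :: "'a groupoid \<Rightarrow> 'a topology \<Rightarrow> bool" where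
  "continuous_operations G T \<longleftrightarrow>
     continuous_map T T (ginv G) \<and>
     continuous_map (subtopology (prod_topology T T) (composable G)) T (\<lambda>(g, h). gmult G g h)"

definition topological_groupoid :: "'a groupoid \<Rightarrow> 'a topology \<Rightarrow> bool" where
  "topological_groupoid G T \<longleftrightarrow>
     is_groupoid G \<and> topological_digraph G T \<and> continuous_operations G T"

definition topological_groupoid_iso ::
  "'a groupoid \<Rightarrow> 'a topology \<Rightarrow> 'b groupoid \<Rightarrow> 'b topology \<Rightarrow> ('a \<Rightarrow> 'b) \<Rightarrow> bool" where
  "topological_groupoid_iso G T H S f \<longleftrightarrow>
     groupoid_hom G H f \<and> bij_betw f (carrier G) (carrier H) \<and> homeomorphic_map T S f"

section \<open>Profinite groupoids\<close>

text \<open>A pair \<open>(i, j) \<in> r\<close> means \<open>i \<le> j\<close>, and then \<open>\<phi> i j\<close> maps \<open>D j\<close> to \<open>D i\<close>.\<close>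

definition inverse_system ::
  "'i set \<Rightarrow> ('i \<times> 'i) set \<Rightarrow> ('i \<Rightarrow> 'c groupoid) \<Rightarrow> ('i \<Rightarrow> 'i \<Rightarrow> 'c \<Rightarrow> 'c) \<Rightarrow> bool" where
  "inverse_system I r D \<phi> \<longleftrightarrow>
     I \<noteq> {} \<and> partial_order_on I r \<and>
     (\<forall>i\<in>I. \<forall>j\<in>I. \<exists>k\<in>I. (i, k) \<in> r \<and> (j, k) \<in> r) \<and>
     (\<forall>i\<in>I. is_groupoid (D i)) \<and>
     (\<forall>(i, j)\<in>r. groupoid_hom (D j) (D i) (\<phi> i j)) \<and>
     (\<forall>i\<in>I. \<forall>x\<in>carrier (D i). \<phi> i i x = x) \<and>
     (\<forall>i j k. (i, j) \<in> r \<longrightarrow> (j, k) \<in> r \<longrightarrow>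
        (\<forall>x\<in>carrier (D k). \<phi> i j (\<phi> j k x) = \<phi> i k x))"

definition inverse_limit ::
  "'i set \<Rightarrow> ('i \<times> 'i) set \<Rightarrow> ('i \<Rightarrow> 'c groupoid) \<Rightarrow> ('i \<Rightarrow> 'i \<Rightarrow> 'c \<Rightarrow> 'c) \<Rightarrow> ('i \<Rightarrow> 'c) groupoid"
  where
  "inverse_limit I r D \<phi> =
     \<lparr>carrier = {x \<in> (\<Pi>\<^sub>E i\<in>I. carrier (D i)). \<forall>(i, j)\<in>r. \<phi> i j (x j) = x i},
      verts = {x \<in> (\<Pi>\<^sub>E i\<in>I. verts (D i)). \<forall>(i, j)\<in>r. \<phi> i j (x j) = x i},
      src = (\<lambda>x. \<lambda>i\<in>I. src (D i) (x i)),
      tgt = (\<lambda>x. \<lambda>i\<in>I. tgt (D i) (x i)),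
      gmult = (\<lambda>x y. \<lambda>i\<in>I. gmult (D i) (x i) (y i)),
      ginv = (\<lambda>x. \<lambda>i\<in>I. ginv (D i) (x i))\<rparr>"

definition inverse_limit_topology ::
  "'i set \<Rightarrow> ('i \<times> 'i) set \<Rightarrow> ('i \<Rightarrow> 'c groupoid) \<Rightarrow> ('i \<Rightarrow> 'i \<Rightarrow> 'c \<Rightarrow> 'c) \<Rightarrow> ('i \<Rightarrow> 'c) topology"
  where
  "inverse_limit_topology I r D \<phi> =
     subtopology (product_topology (\<lambda>i. discrete_topology (carrier (D i))) I)
       (carrier (inverse_limit I r D \<phi>))"

text \<open>
  HOL cannot quantify over types inside a definition, so the type of the indices and that of
  the elements of the finite groupoids are fixed here. No generality is lost: a finite groupoid
  is isomorphic to one with elements in \<open>nat\<close>, and an infinite inverse limit \<open>G\<close> is already the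
  limit of a directed subsystem with at most as many indices as there are subsets of \<open>G \<times> G\<close>
  (keep one index for each kernel of a projection of \<open>G\<close>, and close up under upper bounds and
  under passing from \<open>i\<close> to some \<open>k \<ge> i\<close> for which \<open>D k\<close> and \<open>G\<close> have the same image in \<open>D i\<close>).
  If \<open>G\<close> is finite, one index suffices.
\<close>

definition profinite_groupoid :: "'a groupoid \<Rightarrow> 'a topology \<Rightarrow> bool" where
  "profinite_groupoid G T \<longleftrightarrow>
     topological_groupoid G T \<and>
     (\<exists>(I :: ('a \<times> 'a) set set) r (D :: ('a \<times> 'a) set \<Rightarrow> nat groupoid) \<phi> f.
        inverse_system I r D \<phi> \<and> (\<forall>i\<in>I. finite (carrier (D i))) \<and>
        topological_groupoid_iso G T (inverse_limit I r D \<phi>) (inverse_limit_topology I r D \<phi>) f)"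

section \<open>Uniformities\<close>

text \<open>
  A uniformity on a set \<open>S\<close> is a filter on the whole type \<open>'a \<times> 'a\<close> that contains \<open>S \<times> S\<close>;
  the axioms are those of the type class \<open>uniform_space\<close> relativised to \<open>S\<close>.
\<close>

definition uniformity_on :: "'a set \<Rightarrow> ('a \<times> 'a) filter \<Rightarrow> bool" where
  "uniformity_on S \<U> \<longleftrightarrow>
     \<U> \<le> principal (S \<times> S) \<and>
     (\<forall>E. eventually E \<U> \<longrightarrow>
        (\<forall>x\<in>S. E (x, x)) \<and>
        (\<forall>\<^sub>F (x, y) in \<U>. E (y, x)) \<and>
        (\<exists>D. eventually D \<U> \<and> (\<forall>x y z. D (x, y) \<longrightarrow> D (y, z) \<longrightarrow> E (x, z))))"

definition entourage :: "('a \<times> 'a) filter \<Rightarrow> ('a \<times> 'a) set \<Rightarrow> bool" where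
  "entourage \<U> E \<longleftrightarrow> (\<forall>\<^sub>F p in \<U>. p \<in> E)"

definition Hausdorff_uniformity :: "'a set \<Rightarrow> ('a \<times> 'a) filter \<Rightarrow> bool" where
  "Hausdorff_uniformity S \<U> \<longleftrightarrow>
     uniformity_on S \<U> \<and> (\<forall>x\<in>S. \<forall>y\<in>S. x \<noteq> y \<longrightarrow> (\<exists>E. entourage \<U> E \<and> (x, y) \<notin> E))"

definition compatible_uniformity :: "'a topology \<Rightarrow> ('a \<times> 'a) filter \<Rightarrow> bool" where
  "compatible_uniformity T \<U> \<longleftrightarrow>
     uniformity_on (topspace T) \<U> \<and>
     (\<forall>W. openin T W \<longleftrightarrow>
        W \<subseteq> topspace T \<and> (\<forall>x\<in>W. \<forall>\<^sub>F (x', y) in \<U>. x' = x \<longrightarrow> y \<in> W))"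

definition induced_uniformity ::
  "'a set \<Rightarrow> ('a \<Rightarrow> 'b) \<Rightarrow> ('b \<times> 'b) filter \<Rightarrow> ('a \<times> 'a) filter" where
  "induced_uniformity S j \<V> = inf (filtercomap (map_prod j j) \<V>) (principal (S \<times> S))"

section \<open>Cofinite groupoids\<close>

definition congruence :: "'a groupoid \<Rightarrow> ('a \<times> 'a) set \<Rightarrow> bool" where
  "congruence G \<rho> \<longleftrightarrow> equiv (carrier G) \<rho> \<and> subgroupoid \<rho> (prod_groupoid G G)"

definition rigid :: "'a groupoid \<Rightarrow> ('a \<times> 'a) set \<Rightarrow> bool" where
  "rigid G \<rho> \<longleftrightarrow> \<rho> \<inter> (verts G \<times> verts G) = Id_on (verts G)"

definition cofinite_congruence ::
  "'a groupoid \<Rightarrow> ('a \<times> 'a) filter \<Rightarrow> ('a \<times> 'a) set \<Rightarrow> bool" where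
  "cofinite_congruence G \<U> \<rho> \<longleftrightarrow>
     congruence G \<rho> \<and> finite (carrier G // \<rho>) \<and> entourage \<U> \<rho>"

definition rigid_cofinite_congruences ::
  "'a groupoid \<Rightarrow> ('a \<times> 'a) filter \<Rightarrow> ('a \<times> 'a) set set" where
  "rigid_cofinite_congruences G \<U> = {\<rho>. cofinite_congruence G \<U> \<rho> \<and> rigid G \<rho>}"

definition cofinite_groupoid :: "'a groupoid \<Rightarrow> ('a \<times> 'a) filter \<Rightarrow> bool" where
  "cofinite_groupoid G \<U> \<longleftrightarrow>
     is_groupoid G \<and> Hausdorff_uniformity (carrier G) \<U> \<and>
     (\<forall>E. entourage \<U> E \<longrightarrow> (\<exists>\<rho>. cofinite_congruence G \<U> \<rho> \<and> \<rho> \<subseteq> E))"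

section \<open>Completions\<close>

text \<open>
  \<open>\<Gamma>\<close> with topology \<open>T\<close> is a completion of \<open>G\<close>, the inclusion of \<open>G\<close> being represented by an
  injection \<open>j\<close>, because \<open>G\<close> and its completion need not live in the same type. The uniformity
  \<open>\<V>\<close> is determined by \<open>T\<close>, since a compact Hausdorff space has exactly one compatible uniformity.
\<close>

definition is_completion ::
  "('a, 'm) digraph_scheme \<Rightarrow> ('a \<times> 'a) filter \<Rightarrow>
   ('b, 'n) digraph_scheme \<Rightarrow> 'b topology \<Rightarrow> ('b \<times> 'b) filter \<Rightarrow> ('a \<Rightarrow> 'b) \<Rightarrow> bool" where
  "is_completion G \<U> \<Gamma> T \<V> j \<longleftrightarrow>
     topological_digraph \<Gamma> T \<and> compact_space T \<and> Hausdorff_space T \<and>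
     compatible_uniformity T \<V> \<and>
     digraph_hom G \<Gamma> j \<and> inj_on j (carrier G) \<and>
     T closure_of (j ` carrier G) = carrier \<Gamma> \<and>
     \<U> = induced_uniformity (carrier G) j \<V>"

text \<open>\<open>H\<close> is \<open>\<Gamma>\<close> equipped with continuous operations that extend those of \<open>G\<close> along \<open>j\<close>.\<close>

definition continuous_extension ::
  "'a groupoid \<Rightarrow> 'b digraph \<Rightarrow> 'b topology \<Rightarrow> ('a \<Rightarrow> 'b) \<Rightarrow> 'b groupoid \<Rightarrow> bool" where
  "continuous_extension G \<Gamma> T j H \<longleftrightarrow>
     digraph.truncate H = \<Gamma> \<and> continuous_operations H T \<and>
     (\<forall>g\<in>carrier G. ginv H (j g) = j (ginv G g)) \<and>
     (\<forall>(g, h)\<in>composable G. gmult H (j g) (j h) = j (gmult G g h))"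

definition same_operations :: "'a groupoid \<Rightarrow> 'a groupoid \<Rightarrow> bool" where
  "same_operations H H' \<longleftrightarrow>
     (\<forall>g\<in>carrier H. ginv H' g = ginv H g) \<and>
     (\<forall>(g, h)\<in>composable H. gmult H' g h = gmult H g h)"

end

theory Submission
  imports Defs
begin

text \<open>
  Because \<open>verts G\<close> is finite and the uniformity is Hausdorff, the rigid cofinite congruences
  already form a base. For such \<open>\<rho>\<close> the closure \<open>cl \<rho>\<close> is an equivalence relation on the
  completion with finitely many clopen classes, it induces \<open>\<rho>\<close> on \<open>G\<close>, and related elements have
  equal sources and targets; moreover the relations \<open>cl \<rho>\<close> form a base of the uniformity. Hence
  elements of \<open>G\<close> approximating a composable pair modulo \<open>cl \<rho>\<close> are composable, their product is
  determined modulo \<open>\<rho>\<close>, and compactness yields a unique limit of these products. Every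
  groupoid law, and the fact that \<open>cl \<rho>\<close> is a congruence, holds because it holds modulo each
  \<open>cl \<rho>\<close> for the approximating elements. The completion is then the inverse limit of
  its finite quotients by the \<open>cl \<rho>\<close>. Conversely, a rigid cofinite congruence on the completion is
  clopen, so by density it is the closure of its restriction to \<open>G\<close>.
\<close>

section \<open>Congruences and finite quotients\<close>

text \<open>Products are the obstacle. Extending them continuously and uniquely calls for the
  composable pairs of \<open>G\<close> to be dense among those of the completion, and elements of
  \<open>G\<close> close to a composable pair need not compose in general. Likewise, modulo an
  arbitrary congruence two classes with matching ends may have no composable representatives, so the
  quotient carries no product. Rigidity removes both difficulties: related elements have the same
  source and target, hence composability is a property of classes. Finiteness of the vertex set
  supplies enough rigid congruences, because only finitely many pairs of distinct vertices have to
  be separated. It also makes the image of the vertices closed, so that the completion acquires no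
  new ones. Uniform continuity of the operations on \<open>G\<close> is never stated by itself; it
  is contained in the existence of a base of entourages that the operations respect.\<close>

lemma equiv_reflD: "equiv A r \<Longrightarrow> x \<in> A \<Longrightarrow> (x, x) \<in> r"
  by (auto simp: equiv_def refl_on_def)

lemma equiv_symD: "equiv A r \<Longrightarrow> (x, y) \<in> r \<Longrightarrow> (y, x) \<in> r"
  by (auto simp: equiv_def dest: symD)

lemma equiv_transD: "equiv A r \<Longrightarrow> (x, y) \<in> r \<Longrightarrow> (y, z) \<in> r \<Longrightarrow> (x, z) \<in> r"
  by (auto simp: equiv_def dest: transD)

text \<open>Two pairs compose in the product groupoid exactly when their first and their second
  coordinates do. Being a subgroupoid of the square thus becomes the usual compatibility of a
  relation with the operations, the form used everywhere below.\<close>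

lemma congruence_iff:
  "congruence G \<rho> \<longleftrightarrow> equiv (carrier G) \<rho> \<and>
     (\<forall>x y. (x, y) \<in> \<rho> \<longrightarrow> (src G x, src G y) \<in> \<rho> \<and> (tgt G x, tgt G y) \<in> \<rho> \<and>
        (ginv G x, ginv G y) \<in> \<rho>) \<and>
     (\<forall>x x' y y'. (x, x') \<in> \<rho> \<longrightarrow> (y, y') \<in> \<rho> \<longrightarrow> (x, y) \<in> composable G \<longrightarrow>
        (x', y') \<in> composable G \<longrightarrow> (gmult G x y, gmult G x' y') \<in> \<rho>)"
proof (cases "equiv (carrier G) \<rho>")
  case True
  then have sub: "\<rho> \<subseteq> carrier G \<times> carrier G" by (rule equiv_type)
  have comp: "((x, x'), (y, y')) \<in> composable (prod_groupoid G G) \<longleftrightarrow>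
      (x, y) \<in> composable G \<and> (x', y') \<in> composable G" for x x' y y'
    by (auto simp: composable_def prod_groupoid_def)
  show ?thesis
    unfolding congruence_def subgroupoid_def
    by (simp add: True sub Ball_def split_paired_All comp)
       (auto simp: True prod_groupoid_def sub dest: subsetD[OF sub])
next
  case False
  then show ?thesis by (simp add: congruence_def)
qed

lemma groupoidD:
  assumes "is_groupoid G"
  shows "verts G \<subseteq> carrier G"
    and "g \<in> carrier G \<Longrightarrow> src G g \<in> verts G"
    and "g \<in> carrier G \<Longrightarrow> tgt G g \<in> verts G"
    and "g \<in> carrier G \<Longrightarrow> ginv G g \<in> carrier G"
    and "v \<in> verts G \<Longrightarrow> src G v = v"
    and "v \<in> verts G \<Longrightarrow> tgt G v = v"
    and "(g, h) \<in> composable G \<Longrightarrow> gmult G g h \<in> carrier G"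
    and "(g, h) \<in> composable G \<Longrightarrow> src G (gmult G g h) = src G g"
    and "(g, h) \<in> composable G \<Longrightarrow> tgt G (gmult G g h) = tgt G h"
  using assms by (auto simp: is_groupoid_def is_digraph_def)

lemma congruenceD:
  assumes "congruence G \<rho>"
  shows "equiv (carrier G) \<rho>"
    and "(x, y) \<in> \<rho> \<Longrightarrow> (src G x, src G y) \<in> \<rho>"
    and "(x, y) \<in> \<rho> \<Longrightarrow> (tgt G x, tgt G y) \<in> \<rho>"
    and "(x, y) \<in> \<rho> \<Longrightarrow> (ginv G x, ginv G y) \<in> \<rho>"
    and "(x, x') \<in> \<rho> \<Longrightarrow> (y, y') \<in> \<rho> \<Longrightarrow> (x, y) \<in> composable G \<Longrightarrow>
        (x', y') \<in> composable G \<Longrightarrow> (gmult G x y, gmult G x' y') \<in> \<rho>"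
  using assms unfolding congruence_iff by blast+

lemma congruence_Int:
  assumes "congruence G \<rho>" "congruence G \<sigma>"
  shows "congruence G (\<rho> \<inter> \<sigma>)"
proof -
  have "equiv (carrier G) (\<rho> \<inter> \<sigma>)"
    using congruenceD(1)[OF assms(1)] congruenceD(1)[OF assms(2)]
    unfolding equiv_def refl_on_def sym_def trans_def by blast
  then show ?thesis
    using assms unfolding congruence_iff by auto
qed

lemma rigid_verts_eq:
  "rigid G \<rho> \<Longrightarrow> u \<in> verts G \<Longrightarrow> v \<in> verts G \<Longrightarrow> (u, v) \<in> \<rho> \<Longrightarrow> u = v"
  by (auto simp: rigid_def Id_on_def)

text \<open>A congruence relates the sources of related elements, and on vertices a rigid congruence
  is equality. This is how rigidity enters most arguments: replacing elements by related ones does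
  not affect composability.\<close>

lemma rigid_congruence_src_tgt:
  assumes "is_groupoid G" "congruence G \<rho>" "rigid G \<rho>" "(x, y) \<in> \<rho>"
  shows "src G x = src G y" "tgt G x = tgt G y"
proof -
  have xy: "x \<in> carrier G" "y \<in> carrier G"
    using equiv_type[OF congruenceD(1)[OF assms(2)]] assms(4) by auto
  show "src G x = src G y"
    using xy by (intro rigid_verts_eq[OF assms(3)] groupoidD(2)[OF assms(1)]
        congruenceD(2)[OF assms(2,4)])
  show "tgt G x = tgt G y"
    using xy by (intro rigid_verts_eq[OF assms(3)] groupoidD(3)[OF assms(1)]
        congruenceD(3)[OF assms(2,4)])
qed

text \<open>Each class of the intersection is the intersection of a class of \<open>r\<close> with a
  class of \<open>s\<close>, and there are finitely many such pairs.\<close>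

lemma finite_quotient_Int:
  assumes "equiv A r" "equiv A s" "finite (A // r)" "finite (A // s)"
  shows "finite (A // (r \<inter> s))"
proof -
  have "A // (r \<inter> s) \<subseteq> (\<lambda>(B, C). B \<inter> C) ` ((A // r) \<times> (A // s))"
  proof
    fix B assume "B \<in> A // (r \<inter> s)"
    then obtain x where "x \<in> A" "B = r `` {x} \<inter> s `` {x}"
      by (auto simp: quotient_def)
    then show "B \<in> (\<lambda>(B, C). B \<inter> C) ` ((A // r) \<times> (A // s))"
      by (auto simp: image_iff intro!: bexI[of _ "(r `` {x}, s `` {x})"] quotientI)
  qed
  then show ?thesis
    using assms by (meson finite_SigmaI finite_imageI finite_subset)
qed

section \<open>Finite quotients by rigid congruences\<close>

definition quotient_code :: "'a groupoid \<Rightarrow> ('a \<times> 'a) set \<Rightarrow> 'a \<Rightarrow> nat" where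
  "quotient_code G \<rho> x = to_nat_on (carrier G // \<rho>) (\<rho> `` {x})"

definition quotient_rep :: "'a groupoid \<Rightarrow> ('a \<times> 'a) set \<Rightarrow> nat \<Rightarrow> 'a" where
  "quotient_rep G \<rho> n = (SOME x. x \<in> carrier G \<and> quotient_code G \<rho> x = n)"

text \<open>The elements are numbers because \<open>profinite_groupoid\<close> asks for finite
  groupoids over \<open>nat\<close>. Operations are computed on chosen representatives;
  \<open>ops_code\<close> and \<open>gmult_code\<close> show that the choice is immaterial.\<close>

definition quotient_groupoid :: "'a groupoid \<Rightarrow> ('a \<times> 'a) set \<Rightarrow> nat groupoid" where
  "quotient_groupoid G \<rho> =
     \<lparr>carrier = quotient_code G \<rho> ` carrier G,
      verts = quotient_code G \<rho> ` verts G,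
      src = (\<lambda>m. quotient_code G \<rho> (src G (quotient_rep G \<rho> m))),
      tgt = (\<lambda>m. quotient_code G \<rho> (tgt G (quotient_rep G \<rho> m))),
      gmult = (\<lambda>m n. quotient_code G \<rho> (gmult G (quotient_rep G \<rho> m) (quotient_rep G \<rho> n))),
      ginv = (\<lambda>m. quotient_code G \<rho> (ginv G (quotient_rep G \<rho> m)))\<rparr>"

locale rigid_quotient =
  fixes G :: "'a groupoid" and \<rho> :: "('a \<times> 'a) set"
  assumes groupoid: "is_groupoid G"
    and congruence: "congruence G \<rho>"
    and rigid: "rigid G \<rho>"
    and finite_index: "finite (carrier G // \<rho>)"
begin

lemma code_eq_iff:
  assumes "x \<in> carrier G" "y \<in> carrier G"
  shows "quotient_code G \<rho> x = quotient_code G \<rho> y \<longleftrightarrow> (x, y) \<in> \<rho>"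
  unfolding quotient_code_def
  by (simp add: assms finite_index countable_finite quotientI
      eq_equiv_class_iff[OF congruenceD(1)[OF congruence]])

lemma rep_code:
  assumes "x \<in> carrier G"
  shows "quotient_rep G \<rho> (quotient_code G \<rho> x) \<in> carrier G"
    and "(quotient_rep G \<rho> (quotient_code G \<rho> x), x) \<in> \<rho>"
proof -
  let ?y = "quotient_rep G \<rho> (quotient_code G \<rho> x)"
  have *: "?y \<in> carrier G \<and> quotient_code G \<rho> ?y = quotient_code G \<rho> x"
    unfolding quotient_rep_def by (rule someI[where x = x]) (simp add: assms)
  then show "?y \<in> carrier G" "(?y, x) \<in> \<rho>"
    using code_eq_iff assms by auto
qed

lemma code_rep:
  assumes "n \<in> carrier (quotient_groupoid G \<rho>)"
  shows "quotient_code G \<rho> (quotient_rep G \<rho> n) = n"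
  using assms rep_code code_eq_iff by (auto simp: quotient_groupoid_def)

lemma carrier_quotient: "carrier (quotient_groupoid G \<rho>) = quotient_code G \<rho> ` carrier G"
  and verts_quotient: "verts (quotient_groupoid G \<rho>) = quotient_code G \<rho> ` verts G"
  by (simp_all add: quotient_groupoid_def)

lemma finite_carrier_quotient: "finite (carrier (quotient_groupoid G \<rho>))"
proof -
  have "carrier (quotient_groupoid G \<rho>) \<subseteq> to_nat_on (carrier G // \<rho>) ` (carrier G // \<rho>)"
    by (auto simp: quotient_groupoid_def quotient_code_def quotientI)
  then show ?thesis
    using finite_index by (meson finite_imageI finite_subset)
qed

lemma ops_code:
  assumes "x \<in> carrier G"
  shows "src (quotient_groupoid G \<rho>) (quotient_code G \<rho> x) = quotient_code G \<rho> (src G x)"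
    and "tgt (quotient_groupoid G \<rho>) (quotient_code G \<rho> x) = quotient_code G \<rho> (tgt G x)"
    and "ginv (quotient_groupoid G \<rho>) (quotient_code G \<rho> x) = quotient_code G \<rho> (ginv G x)"
  using rep_code[OF assms] congruenceD(2-4)[OF congruence rep_code(2)[OF assms]] assms
    groupoidD(1-4)[OF groupoid]
  by (auto simp: quotient_groupoid_def code_eq_iff subset_iff)

text \<open>Matching codes say that the vertices \<open>tgt G x\<close> and \<open>src G y\<close>
  are related, and rigidity turns this into equality. Every composable pair of the quotient
  therefore lifts, with any choice of representatives.\<close>

lemma composable_code:
  assumes "x \<in> carrier G" "y \<in> carrier G"
  shows "(quotient_code G \<rho> x, quotient_code G \<rho> y) \<in> composable (quotient_groupoid G \<rho>) \<longleftrightarrow>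
    (x, y) \<in> composable G"
proof -
  have v: "tgt G x \<in> verts G" "src G y \<in> verts G"
    using groupoidD(2,3)[OF groupoid] assms by auto
  then have "quotient_code G \<rho> (tgt G x) = quotient_code G \<rho> (src G y) \<longleftrightarrow> tgt G x = src G y"
    using code_eq_iff[of "tgt G x" "src G y"] groupoidD(1)[OF groupoid] rigid_verts_eq[OF rigid v]
    by auto
  then show ?thesis
    using assms by (auto simp: composable_def ops_code carrier_quotient)
qed

lemma gmult_code:
  assumes "(x, y) \<in> composable G"
  shows "gmult (quotient_groupoid G \<rho>) (quotient_code G \<rho> x) (quotient_code G \<rho> y) =
    quotient_code G \<rho> (gmult G x y)"
proof -
  let ?x = "quotient_rep G \<rho> (quotient_code G \<rho> x)"
    and ?y = "quotient_rep G \<rho> (quotient_code G \<rho> y)"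
  have xy: "x \<in> carrier G" "y \<in> carrier G"
    using assms by (auto simp: composable_def)
  \<comment> \<open>The chosen representatives have the same sources and targets as \<open>x\<close>
    and \<open>y\<close> by rigidity, so their product is meaningful.\<close>
  have c: "(?x, ?y) \<in> composable G"
    using rep_code[OF xy(1)] rep_code[OF xy(2)] assms
      rigid_congruence_src_tgt[OF groupoid congruence rigid]
    by (simp add: composable_def)
  have "(gmult G ?x ?y, gmult G x y) \<in> \<rho>"
    using congruenceD(5)[OF congruence] rep_code xy c assms by metis
  then show ?thesis
    using c assms groupoidD(7)[OF groupoid] code_eq_iff by (simp add: quotient_groupoid_def)
qed

text \<open>All elements are codes and all composable pairs lift to composable pairs of
  \<open>G\<close>, so each law is the code of the same law in \<open>G\<close>.\<close>

lemma is_groupoid_quotient: "is_groupoid (quotient_groupoid G \<rho>)"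
proof -
  let ?Q = "quotient_groupoid G \<rho>" and ?c = "quotient_code G \<rho>"
  note gr = groupoidD[OF groupoid]
  have car: "v \<in> carrier G" if "v \<in> verts G" for v
    using that gr(1) by auto
  have digraph: "is_digraph ?Q"
    using car gr(2,3,5,6) by (auto simp: is_digraph_def carrier_quotient verts_quotient ops_code)
  have assoc: "gmult ?Q (gmult ?Q m n) k = gmult ?Q m (gmult ?Q n k)"
    if mn: "(m, n) \<in> composable ?Q" and nk: "(n, k) \<in> composable ?Q" for m n k
  proof -
    obtain x y z where eq: "m = ?c x" "n = ?c y" "k = ?c z"
      and xyz: "x \<in> carrier G" "y \<in> carrier G" "z \<in> carrier G"
      using mn nk by (auto simp: composable_def carrier_quotient)
    have c: "(x, y) \<in> composable G" "(y, z) \<in> composable G"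
      using mn nk xyz by (simp_all add: eq composable_code)
    then have c': "(gmult G x y, z) \<in> composable G" "(x, gmult G y z) \<in> composable G"
      using gr(7-9) xyz by (auto simp: composable_def)
    show ?thesis
      using groupoid c by (simp add: eq gmult_code c c' is_groupoid_def)
  qed
  have mult: "gmult ?Q m n \<in> carrier ?Q \<and> src ?Q (gmult ?Q m n) = src ?Q m \<and>
      tgt ?Q (gmult ?Q m n) = tgt ?Q n" if mn: "(m, n) \<in> composable ?Q" for m n
  proof -
    obtain x y where eq: "m = ?c x" "n = ?c y" and xy: "x \<in> carrier G" "y \<in> carrier G"
      using mn by (auto simp: composable_def carrier_quotient)
    have c: "(x, y) \<in> composable G"
      using mn xy by (simp add: eq composable_code)
    show ?thesis
      using gr(7-9)[OF c] xy by (simp add: eq gmult_code c ops_code carrier_quotient)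
  qed
  have unit: "gmult ?Q (src ?Q m) m = m \<and> gmult ?Q m (tgt ?Q m) = m"
    if m: "m \<in> carrier ?Q" for m
  proof -
    obtain x where eq: "m = ?c x" and x: "x \<in> carrier G"
      using m by (auto simp: carrier_quotient)
    have "(src G x, x) \<in> composable G" "(x, tgt G x) \<in> composable G"
      using x gr(2,3,5,6) car by (auto simp: composable_def)
    then show ?thesis
      using groupoid x by (simp add: eq ops_code gmult_code is_groupoid_def)
  qed
  have inv: "ginv ?Q m \<in> carrier ?Q \<and> src ?Q (ginv ?Q m) = tgt ?Q m \<and>
      tgt ?Q (ginv ?Q m) = src ?Q m \<and> gmult ?Q m (ginv ?Q m) = src ?Q m \<and>
      gmult ?Q (ginv ?Q m) m = tgt ?Q m"
    if m: "m \<in> carrier ?Q" for m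
  proof -
    obtain x where eq: "m = ?c x" and x: "x \<in> carrier G"
      using m by (auto simp: carrier_quotient)
    have i: "ginv G x \<in> carrier G" "src G (ginv G x) = tgt G x" "tgt G (ginv G x) = src G x"
        "gmult G x (ginv G x) = src G x" "gmult G (ginv G x) x = tgt G x"
      using groupoid x by (auto simp: is_groupoid_def)
    have "(ginv G x, x) \<in> composable G" "(x, ginv G x) \<in> composable G"
      using x i by (auto simp: composable_def)
    then show ?thesis
      using x by (simp add: eq ops_code gmult_code i carrier_quotient)
  qed
  show ?thesis
    unfolding is_groupoid_def using digraph assoc mult unit inv by auto
qed

end

section \<open>A criterion for profiniteness\<close>

text \<open>Directedness places a nonempty member of the family below every finite intersection,
  which yields the finite intersection property. It serves twice: to hit every point of an inverse
  limit, and to produce limits in the completion.\<close>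

lemma compact_space_directed_closed:
  assumes "compact_space X" "I \<noteq> {}"
    and closed: "\<And>i. i \<in> I \<Longrightarrow> closedin X (K i)"
    and ne: "\<And>i. i \<in> I \<Longrightarrow> K i \<noteq> {}"
    and directed: "\<And>i k. i \<in> I \<Longrightarrow> k \<in> I \<Longrightarrow> \<exists>l\<in>I. K l \<subseteq> K i \<inter> K k"
  obtains z where "z \<in> topspace X" "\<And>i. i \<in> I \<Longrightarrow> z \<in> K i"
proof -
  have below: "\<exists>l\<in>I. K l \<subseteq> \<Inter>(K ` J)" if "finite J" "J \<subseteq> I" for J
    using that
  proof (induction J)
    case empty
    then show ?case using assms(2) by auto
  next
    case (insert i J)
    then obtain l where "l \<in> I" "K l \<subseteq> \<Inter>(K ` J)" by auto
    moreover obtain m where "m \<in> I" "K m \<subseteq> K i \<inter> K l"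
      using directed[of i l] insert.prems calculation(1) by auto
    ultimately show ?case by (intro bexI[of _ m]) auto
  qed
  have "\<Inter>(K ` I) \<noteq> {}"
  proof -
    have "\<Inter>\<F> \<noteq> {}" if "finite \<F>" "\<F> \<subseteq> K ` I" for \<F>
    proof -
      obtain J where "finite J" "J \<subseteq> I" "\<F> = K ` J"
        using \<open>finite \<F>\<close> \<open>\<F> \<subseteq> K ` I\<close> by (meson finite_subset_image)
      then show ?thesis
        using below[of J] ne by fastforce
    qed
    moreover have "\<forall>C\<in>K ` I. closedin X C"
      using closed by auto
    ultimately show ?thesis
      using assms(1) unfolding compact_space_fip by (metis (no_types, lifting))
  qed
  then obtain z where z: "\<And>i. i \<in> I \<Longrightarrow> z \<in> K i" by auto
  then have "z \<in> topspace X"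
    using assms(2) closed closedin_subset by blast
  then show thesis using z that by blast
qed

text \<open>The complement of a class is a union of other classes, which are open.\<close>

lemma closedin_equiv_class:
  assumes "equiv (topspace X) r" "\<And>x. x \<in> topspace X \<Longrightarrow> openin X (r `` {x})"
  shows "closedin X (r `` {x})"
proof -
  have "topspace X - r `` {x} = \<Union>((\<lambda>y. r `` {y}) ` (topspace X - r `` {x}))"
  proof (intro equalityI subsetI)
    fix y assume "y \<in> topspace X - r `` {x}"
    then show "y \<in> \<Union>((\<lambda>y. r `` {y}) ` (topspace X - r `` {x}))"
      using equiv_reflD[OF assms(1)] by blast
  next
    fix z assume "z \<in> \<Union>((\<lambda>y. r `` {y}) ` (topspace X - r `` {x}))"
    then obtain y where y: "y \<in> topspace X" "(x, y) \<notin> r" "(y, z) \<in> r" by auto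
    then show "z \<in> topspace X - r `` {x}"
      using equiv_type[OF assms(1)] equiv_symD[OF assms(1)] equiv_transD[OF assms(1)]
      by blast
  qed
  moreover have "openin X (\<Union>((\<lambda>y. r `` {y}) ` (topspace X - r `` {x})))"
    using assms(2) by blast
  ultimately have "openin X (topspace X - r `` {x})" by simp
  moreover have "r `` {x} \<subseteq> topspace X"
    using equiv_type[OF assms(1)] by auto
  ultimately show ?thesis by (simp add: closedin_def)
qed

text \<open>The members of \<open>\<R>\<close> index their own quotients, directed by intersection.
  Sending \<open>x\<close> to the family of its codes is injective by \<open>sep\<close> and
  surjective by compactness; it is continuous because classes are open. A continuous bijection from
  a compact space to a Hausdorff space is a homeomorphism.\<close>

lemma profinite_groupoidI:
  assumes top: "topological_groupoid H T" and compact: "compact_space T"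
    and ne: "\<R> \<noteq> {}"
    and cong: "\<And>R. R \<in> \<R> \<Longrightarrow> congruence H R"
    and rigid: "\<And>R. R \<in> \<R> \<Longrightarrow> rigid H R"
    and fin: "\<And>R. R \<in> \<R> \<Longrightarrow> finite (carrier H // R)"
    and "open": "\<And>R x. R \<in> \<R> \<Longrightarrow> x \<in> carrier H \<Longrightarrow> openin T (R `` {x})"
    and Int: "\<And>R S. R \<in> \<R> \<Longrightarrow> S \<in> \<R> \<Longrightarrow> R \<inter> S \<in> \<R>"
    and sep: "\<And>x y. x \<in> carrier H \<Longrightarrow> y \<in> carrier H \<Longrightarrow> (\<And>R. R \<in> \<R> \<Longrightarrow> (x, y) \<in> R) \<Longrightarrow> x = y"
  shows "profinite_groupoid H T"
proof -
  have gr: "is_groupoid H" and topspace: "topspace T = carrier H"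
    using top by (auto simp: topological_groupoid_def topological_digraph_def)
  have quot: "rigid_quotient H R" if "R \<in> \<R>" for R
    using that gr cong rigid fin by unfold_locales auto
  note code = rigid_quotient.code_eq_iff[OF quot]
    and rep = rigid_quotient.rep_code[OF quot]
    and code_rep = rigid_quotient.code_rep[OF quot]
    and ops = rigid_quotient.ops_code[OF quot]
    and composable = rigid_quotient.composable_code[OF quot]
    and gmult = rigid_quotient.gmult_code[OF quot]
    and car = rigid_quotient.carrier_quotient[OF quot]
    and eqv = congruenceD(1)[OF cong]
  define D where "D = quotient_groupoid H"
  \<comment> \<open>The larger index is the finer congruence, matching transition maps that go from
    the larger index to the smaller.\<close>
  define r where "r = {(R, S). R \<in> \<R> \<and> S \<in> \<R> \<and> S \<subseteq> R}"
  define \<phi> where "\<phi> = (\<lambda>R S n. quotient_code H R (quotient_rep H S n))"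
  \<comment> \<open>A representative modulo \<open>S\<close> is also one modulo the coarser
    \<open>R\<close>, so the choice made by \<open>quotient_rep\<close> does not influence the
    transition map.\<close>
  have \<phi>: "\<phi> R S (quotient_code H S x) = quotient_code H R x"
    if "(R, S) \<in> r" "x \<in> carrier H" for R S x
    using that code[of R "quotient_rep H S (quotient_code H S x)" x] rep[of S x]
    by (auto simp: \<phi>_def r_def)
  have D_car: "carrier (D R) = quotient_code H R ` carrier H" if "R \<in> \<R>" for R
    using car[OF that] by (simp add: D_def)
  have hom: "groupoid_hom (D S) (D R) (\<phi> R S)" if RS: "(R, S) \<in> r" for R S
  proof -
    have m: "R \<in> \<R>" "S \<in> \<R>" using RS by (auto simp: r_def)
    have "\<phi> R S (gmult (D S) m n) = gmult (D R) (\<phi> R S m) (\<phi> R S n)"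
      if mn: "(m, n) \<in> composable (D S)" for m n
    proof -
      obtain x y where eq: "m = quotient_code H S x" "n = quotient_code H S y"
        and xy: "x \<in> carrier H" "y \<in> carrier H"
        using mn D_car[OF m(2)] by (auto simp: composable_def)
      have c: "(x, y) \<in> composable H"
        using mn composable[OF m(2) xy] by (simp add: eq D_def)
      show ?thesis
        using gmult[OF m(1) c] gmult[OF m(2) c] \<phi>[OF RS] xy groupoidD(7)[OF gr c]
        by (simp add: eq D_def)
    qed
    moreover have "digraph_hom (D S) (D R) (\<phi> R S)"
      using m D_car groupoidD(1-3)[OF gr]
      by (auto simp: digraph_hom_def \<phi>[OF RS] D_def ops subset_iff)
    ultimately show ?thesis by (auto simp: groupoid_hom_def)
  qed
  have "inverse_system \<R> r D \<phi>"
    unfolding inverse_system_def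
  proof (intro conjI)
    show "\<R> \<noteq> {}" by (fact ne)
    show "partial_order_on \<R> r"
      by (auto simp: partial_order_on_def preorder_on_def r_def refl_on_def trans_def antisym_def)
    show "\<forall>i\<in>\<R>. \<forall>j\<in>\<R>. \<exists>k\<in>\<R>. (i, k) \<in> r \<and> (j, k) \<in> r"
    proof (intro ballI)
      fix i j assume "i \<in> \<R>" "j \<in> \<R>"
      then show "\<exists>k\<in>\<R>. (i, k) \<in> r \<and> (j, k) \<in> r"
        using Int by (intro bexI[of _ "i \<inter> j"]) (auto simp: r_def)
    qed
    show "\<forall>i\<in>\<R>. is_groupoid (D i)"
      using rigid_quotient.is_groupoid_quotient[OF quot] by (simp add: D_def)
    show "\<forall>(i, j)\<in>r. groupoid_hom (D j) (D i) (\<phi> i j)"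
      using hom by auto
    show "\<forall>i\<in>\<R>. \<forall>x\<in>carrier (D i). \<phi> i i x = x"
      using code_rep by (simp add: \<phi>_def D_def)
    show "\<forall>i j k. (i, j) \<in> r \<longrightarrow> (j, k) \<in> r \<longrightarrow>
        (\<forall>x\<in>carrier (D k). \<phi> i j (\<phi> j k x) = \<phi> i k x)"
    proof (intro allI impI ballI)
      fix i j k x assume ij: "(i, j) \<in> r" and jk: "(j, k) \<in> r" and x: "x \<in> carrier (D k)"
      then have "k \<in> \<R>" and ik: "(i, k) \<in> r" by (auto simp: r_def)
      then obtain y where "y \<in> carrier H" "x = quotient_code H k y"
        using x D_car by auto
      then show "\<phi> i j (\<phi> j k x) = \<phi> i k x"
        using \<phi>[OF ij] \<phi>[OF jk] \<phi>[OF ik] by simp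
    qed
  qed
  moreover have finD: "finite (carrier (D R))" if "R \<in> \<R>" for R
    using rigid_quotient.finite_carrier_quotient[OF quot] that by (simp add: D_def)
  moreover
  define L where "L = inverse_limit \<R> r D \<phi>"
  define TL where "TL = inverse_limit_topology \<R> r D \<phi>"
  define f where "f = (\<lambda>x. \<lambda>R\<in>\<R>. quotient_code H R x)"
  have f_car: "f x \<in> carrier L" if "x \<in> carrier H" for x
  proof -
    have "\<phi> R S (f x S) = f x R" if "(R, S) \<in> r" for R S
      using \<phi>[OF that \<open>x \<in> carrier H\<close>] that by (auto simp: f_def r_def)
    moreover have "f x \<in> (\<Pi>\<^sub>E i\<in>\<R>. carrier (D i))"
      using that D_car by (auto simp: f_def)
    ultimately show ?thesis
      unfolding L_def inverse_limit_def by auto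
  qed
  have inj: "inj_on f (carrier H)"
  proof (rule inj_onI)
    fix x y assume xy: "x \<in> carrier H" "y \<in> carrier H" and eq: "f x = f y"
    have "(x, y) \<in> R" if "R \<in> \<R>" for R
      using fun_cong[OF eq, of R] code[OF that xy] that by (simp add: f_def)
    then show "x = y" using sep xy by blast
  qed
  have surj: "z \<in> f ` carrier H" if z: "z \<in> carrier L" for z
  proof -
    have zR: "z R \<in> quotient_code H R ` carrier H" if "R \<in> \<R>" for R
      using z that D_car[OF that] by (auto simp: L_def inverse_limit_def)
    have z\<phi>: "\<phi> R S (z S) = z R" if "(R, S) \<in> r" for R S
      using z that by (auto simp: L_def inverse_limit_def)
    \<comment> \<open>\<open>K R\<close> is the fibre of the coordinate \<open>R\<close> over
      \<open>z R\<close>. It is a single class, hence closed, and compatibility of \<open>z\<close>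
      makes these fibres decrease along the system; a common point is a preimage of
      \<open>z\<close>.\<close>
    define K where "K = (\<lambda>R. {x \<in> carrier H. quotient_code H R x = z R})"
    have K_class: "K R = R `` {x}" if R: "R \<in> \<R>" and x: "x \<in> K R" for R x
    proof -
      have "K R = {y \<in> carrier H. quotient_code H R x = quotient_code H R y}"
        using x by (auto simp: K_def)
      also have "\<dots> = {y \<in> carrier H. (x, y) \<in> R}"
        using x code[OF R, of x] by (auto simp: K_def)
      also have "\<dots> = R `` {x}"
        using equiv_type[OF eqv[OF R]] by auto
      finally show ?thesis .
    qed
    have K_ne: "K R \<noteq> {}" if "R \<in> \<R>" for R
      using zR[OF that] by (auto simp: K_def)
    have K_closed: "closedin T (K R)" if R: "R \<in> \<R>" for R
    proof -
      obtain x where "x \<in> K R" using K_ne[OF R] by blast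
      then show ?thesis
        using closedin_equiv_class[of T R x] K_class[OF R] eqv[OF R] "open"[OF R] topspace by simp
    qed
    have K_mono: "K S \<subseteq> K R" if "(R, S) \<in> r" for R S
    proof
      fix x assume "x \<in> K S"
      then show "x \<in> K R"
        using \<phi>[OF that, of x] z\<phi>[OF that] by (auto simp: K_def)
    qed
    have K_dir: "\<exists>Q\<in>\<R>. K Q \<subseteq> K R \<inter> K S" if "R \<in> \<R>" "S \<in> \<R>" for R S
      using that Int[OF that] K_mono[of R "R \<inter> S"] K_mono[of S "R \<inter> S"]
      by (intro bexI[of _ "R \<inter> S"]) (auto simp: r_def)
    obtain x where x: "x \<in> topspace T" "\<And>R. R \<in> \<R> \<Longrightarrow> x \<in> K R"
      using compact_space_directed_closed[OF compact ne K_closed K_ne K_dir] by blast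
    have "f x = z"
    proof (rule extensionalityI)
      show "f x \<in> extensional \<R>" by (simp add: f_def)
      show "z \<in> extensional \<R>" using z by (auto simp: L_def inverse_limit_def PiE_def)
      show "f x R = z R" if "R \<in> \<R>" for R
        using x(2)[OF that] that by (simp add: f_def K_def)
    qed
    then show ?thesis using x(1) topspace by blast
  qed
  have bij: "bij_betw f (carrier H) (carrier L)"
    using inj surj f_car by (auto simp: bij_betw_def)
  have fhom: "groupoid_hom H L f"
  proof -
    have "f (gmult H x y) = gmult L (f x) (f y)" if "(x, y) \<in> composable H" for x y
      using gmult[OF _ that] by (auto simp: f_def L_def inverse_limit_def D_def intro!: restrict_ext)
    moreover have "f (src H x) = src L (f x)" "f (tgt H x) = tgt L (f x)" if "x \<in> carrier H" for x
      using ops[OF _ that] by (auto simp: f_def L_def inverse_limit_def D_def intro!: restrict_ext)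
    ultimately show ?thesis
      using f_car by (auto simp: groupoid_hom_def digraph_hom_def)
  qed
  have L_sub: "carrier L \<subseteq> (\<Pi>\<^sub>E i\<in>\<R>. carrier (D i))"
    by (auto simp: L_def inverse_limit_def)
  have topL: "topspace TL = carrier L"
    using L_sub by (auto simp: TL_def inverse_limit_topology_def L_def[symmetric])
  have cont: "continuous_map T TL f"
    unfolding TL_def inverse_limit_topology_def L_def[symmetric]
  proof (rule continuous_map_into_subtopology)
    show "f \<in> topspace T \<rightarrow> carrier L" using f_car topspace by auto
    show "continuous_map T (product_topology (\<lambda>i. discrete_topology (carrier (D i))) \<R>) f"
      unfolding continuous_map_componentwise
    proof (intro conjI ballI)
      show "f ` topspace T \<subseteq> extensional \<R>" by (auto simp: f_def)
      fix R assume R: "R \<in> \<R>"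
      \<comment> \<open>The coordinate at \<open>R\<close> is constant on the open classes of
        \<open>R\<close>, so every preimage is a union of such classes.\<close>
      have "openin T {x \<in> topspace T. f x R \<in> W}" for W
      proof (subst openin_subopen, intro ballI)
        fix x assume "x \<in> {x \<in> topspace T. f x R \<in> W}"
        then have x: "x \<in> carrier H" "quotient_code H R x \<in> W"
          using topspace R by (auto simp: f_def)
        have "R `` {x} \<subseteq> {x \<in> topspace T. f x R \<in> W}"
          using x R topspace equiv_type[OF eqv[OF R]] code[OF R] by (fastforce simp: f_def)
        then show "\<exists>A. openin T A \<and> x \<in> A \<and> A \<subseteq> {x \<in> topspace T. f x R \<in> W}"
          using "open"[OF R x(1)] equiv_reflD[OF eqv[OF R] x(1)] by blast
      qed
      then show "continuous_map T (discrete_topology (carrier (D R))) (\<lambda>x. f x R)"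
        using R D_car[OF R] topspace by (auto simp: continuous_map_def f_def)
    qed
  qed
  have "Hausdorff_space TL"
    unfolding TL_def inverse_limit_topology_def
    by (intro Hausdorff_space_subtopology) (simp add: Hausdorff_space_product_topology)
  then have "homeomorphic_map T TL f"
    using bij inj by (intro continuous_imp_homeomorphic_map cont compact)
      (auto simp: topspace topL bij_betw_def)
  ultimately have "inverse_system \<R> r D \<phi> \<and> (\<forall>R\<in>\<R>. finite (carrier (D R))) \<and>
      topological_groupoid_iso H T (inverse_limit \<R> r D \<phi>) (inverse_limit_topology \<R> r D \<phi>) f"
    using bij fhom by (simp add: topological_groupoid_iso_def L_def TL_def)
  then show ?thesis
    using top unfolding profinite_groupoid_def by blast
qed

section \<open>Uniformities\<close>

lemma entourage_mono: "entourage \<U> E \<Longrightarrow> E \<subseteq> F \<Longrightarrow> entourage \<U> F"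
  unfolding entourage_def by (erule eventually_mono) auto

lemma entourage_Int: "entourage \<U> E \<Longrightarrow> entourage \<U> F \<Longrightarrow> entourage \<U> (E \<inter> F)"
  unfolding entourage_def by (simp add: eventually_conj_iff)

lemma uniformity_on_entourageD:
  assumes "uniformity_on S \<U>" "entourage \<U> E"
  shows "x \<in> S \<Longrightarrow> (x, x) \<in> E"
    and "entourage \<U> (E\<inverse>)"
    and "\<exists>D. entourage \<U> D \<and> D O D \<subseteq> E"
proof -
  have E: "\<forall>x\<in>S. (x, x) \<in> E" "\<forall>\<^sub>F (x, y) in \<U>. (y, x) \<in> E"
    "\<exists>D. eventually D \<U> \<and> (\<forall>x y z. D (x, y) \<longrightarrow> D (y, z) \<longrightarrow> (x, z) \<in> E)"
    using assms unfolding uniformity_on_def entourage_def by blast+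
  show "x \<in> S \<Longrightarrow> (x, x) \<in> E" using E(1) by blast
  show "entourage \<U> (E\<inverse>)"
    using E(2) by (simp add: entourage_def converse_unfold split_def)
  obtain D where D: "eventually D \<U>" "\<And>x y z. D (x, y) \<Longrightarrow> D (y, z) \<Longrightarrow> (x, z) \<in> E"
    using E(3) by blast
  then have "entourage \<U> (Collect D) \<and> Collect D O Collect D \<subseteq> E"
    by (auto simp: entourage_def)
  then show "\<exists>D. entourage \<U> D \<and> D O D \<subseteq> E" by blast
qed

text \<open>Halving twice and symmetrising. Three steps are what is needed to pass between two
  points through a neighbour of each, as in \<open>entourage_cl\<close> and
  \<open>cl_refinement\<close>.\<close>

lemma uniformity_on_third:
  assumes U: "uniformity_on S \<U>" and E: "entourage \<U> E"
  obtains D where "entourage \<U> D" "D \<subseteq> S \<times> S"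
    "\<And>x y. (x, y) \<in> D \<Longrightarrow> (y, x) \<in> D"
    "\<And>x y z w. (x, y) \<in> D \<Longrightarrow> (y, z) \<in> D \<Longrightarrow> (z, w) \<in> D \<Longrightarrow> (x, w) \<in> E"
proof -
  obtain D1 where D1: "entourage \<U> D1" "D1 O D1 \<subseteq> E"
    using uniformity_on_entourageD(3)[OF U E] by blast
  obtain D2 where D2: "entourage \<U> D2" "D2 O D2 \<subseteq> D1"
    using uniformity_on_entourageD(3)[OF U D1(1)] by blast
  have S: "entourage \<U> (S \<times> S)"
    using U by (simp add: uniformity_on_def entourage_def le_principal)
  \<comment> \<open>Two steps in \<open>D2\<close> make one in \<open>D1\<close>; intersecting with
    \<open>D1\<close> as well lets the third step count as the second \<open>D1\<close>
    step.\<close>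
  define C where "C = D1 \<inter> D2 \<inter> (S \<times> S)"
  have C: "entourage \<U> C"
    unfolding C_def by (intro entourage_Int D1 D2 S)
  show thesis
  proof (rule that[of "C \<inter> C\<inverse>"])
    show "entourage \<U> (C \<inter> C\<inverse>)"
      by (intro entourage_Int C uniformity_on_entourageD(2)[OF U C])
    show "C \<inter> C\<inverse> \<subseteq> S \<times> S" by (auto simp: C_def)
    show "(y, x) \<in> C \<inter> C\<inverse>" if "(x, y) \<in> C \<inter> C\<inverse>" for x y
      using that by auto
    show "(x, w) \<in> E"
      if "(x, y) \<in> C \<inter> C\<inverse>" "(y, z) \<in> C \<inter> C\<inverse>" "(z, w) \<in> C \<inter> C\<inverse>" for x y z w
    proof -
      have "(x, z) \<in> D1" using that D2(2) by (auto simp: C_def)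
      moreover have "(z, w) \<in> D1" using that by (auto simp: C_def)
      ultimately show ?thesis using D1(2) by auto
    qed
  qed
qed

text \<open>The slice of \<open>E\<close> at \<open>x\<close> need not be open, so its uniform
  interior is taken: the points some slice of which stays inside it. Halving a witness
  \<open>D\<close> shows that this set is open, and reflexivity of entourages that it lies in the
  slice.\<close>

lemma compatible_uniformity_nhd:
  assumes comp: "compatible_uniformity T \<V>" and E: "entourage \<V> E" and x: "x \<in> topspace T"
  obtains W where "openin T W" "x \<in> W" "\<And>y. y \<in> W \<Longrightarrow> (x, y) \<in> E"
proof -
  have U: "uniformity_on (topspace T) \<V>"
    using comp by (simp add: compatible_uniformity_def)
  define W where "W = {y \<in> topspace T. \<exists>D. entourage \<V> D \<and> (\<forall>z. (y, z) \<in> D \<longrightarrow> (x, z) \<in> E)}"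
  have "\<forall>\<^sub>F (y', z) in \<V>. y' = y \<longrightarrow> z \<in> W" if y: "y \<in> W" for y
  proof -
    obtain D where D: "entourage \<V> D" "\<And>z. (y, z) \<in> D \<Longrightarrow> (x, z) \<in> E"
      using y by (auto simp: W_def)
    obtain D' where D': "entourage \<V> D'" "D' O D' \<subseteq> D"
      using uniformity_on_entourageD(3)[OF U D(1)] by blast
    have "z \<in> W" if "(y, z) \<in> D'" "z \<in> topspace T" for z
      using that D' D(2) by (auto simp: W_def)
    moreover have "entourage \<V> (D' \<inter> topspace T \<times> topspace T)"
      using D' U by (intro entourage_Int) (simp_all add: uniformity_on_def entourage_def le_principal)
    ultimately show ?thesis
      unfolding entourage_def by (auto elim!: eventually_mono)
  qed
  then have "openin T W"
    using comp unfolding compatible_uniformity_def by (auto simp: W_def)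
  moreover have "x \<in> W" using x E by (auto simp: W_def)
  moreover have "(x, y) \<in> E" if "y \<in> W" for y
    using that uniformity_on_entourageD(1)[OF U] by (auto simp: W_def)
  ultimately show thesis using that by blast
qed

lemma compatible_uniformity_openinD:
  assumes "compatible_uniformity T \<V>" "openin T W" "x \<in> W"
  shows "entourage \<V> {(a, b). a = x \<longrightarrow> b \<in> W}"
  using assms unfolding compatible_uniformity_def entourage_def by auto

text \<open>By transitivity a class contains the slice of \<open>R\<close> at each of its points, so
  for an equivalence relation no passage to an interior is required.\<close>

lemma openin_entourage_class:
  assumes comp: "compatible_uniformity T \<V>" and R: "equiv (topspace T) R" and E: "entourage \<V> R"
  shows "openin T (R `` {x})"
proof -
  have "\<forall>\<^sub>F (y', z) in \<V>. y' = y \<longrightarrow> z \<in> R `` {x}" if "y \<in> R `` {x}" for y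
    using E unfolding entourage_def
    by (rule eventually_mono) (use that equiv_transD[OF R] in auto)
  moreover have "R `` {x} \<subseteq> topspace T"
    using equiv_type[OF R] by auto
  ultimately show ?thesis
    using comp unfolding compatible_uniformity_def by auto
qed

text \<open>This provides directedness. It is stated for an arbitrary groupoid since it is applied
  both to \<open>G\<close> and to its completion.\<close>

lemma rigid_cofinite_congruences_Int:
  assumes "\<rho> \<in> rigid_cofinite_congruences G \<U>" "\<sigma> \<in> rigid_cofinite_congruences G \<U>"
  shows "\<rho> \<inter> \<sigma> \<in> rigid_cofinite_congruences G \<U>"
proof -
  have \<rho>: "congruence G \<rho>" "rigid G \<rho>" "finite (carrier G // \<rho>)" "entourage \<U> \<rho>"
    and \<sigma>: "congruence G \<sigma>" "rigid G \<sigma>" "finite (carrier G // \<sigma>)" "entourage \<U> \<sigma>"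
    using assms by (simp_all add: rigid_cofinite_congruences_def cofinite_congruence_def)
  have "congruence G (\<rho> \<inter> \<sigma>)"
    by (rule congruence_Int[OF \<rho>(1) \<sigma>(1)])
  moreover have "finite (carrier G // (\<rho> \<inter> \<sigma>))"
    by (rule finite_quotient_Int[OF congruenceD(1)[OF \<rho>(1)] congruenceD(1)[OF \<sigma>(1)] \<rho>(3) \<sigma>(3)])
  moreover have "entourage \<U> (\<rho> \<inter> \<sigma>)"
    by (rule entourage_Int[OF \<rho>(4) \<sigma>(4)])
  moreover have "rigid G (\<rho> \<inter> \<sigma>)"
  proof -
    have "\<rho> \<inter> \<sigma> \<inter> verts G \<times> verts G =
        (\<rho> \<inter> verts G \<times> verts G) \<inter> (\<sigma> \<inter> verts G \<times> verts G)" by auto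
    then show ?thesis
      using \<rho>(2) \<sigma>(2) unfolding rigid_def by simp
  qed
  ultimately show ?thesis
    by (simp add: rigid_cofinite_congruences_def cofinite_congruence_def)
qed

section \<open>Closures of rigid cofinite congruences\<close>

locale finite_vertex_completion =
  fixes G :: "'a groupoid" and \<U> :: "('a \<times> 'a) filter"
    and \<Gamma> :: "'b digraph" and T :: "'b topology" and \<V> :: "('b \<times> 'b) filter"
    and j :: "'a \<Rightarrow> 'b"
  assumes cofinite: "cofinite_groupoid G \<U>"
    and finite_verts: "finite (verts G)"
    and completion: "is_completion G \<U> \<Gamma> T \<V> j"
begin

abbreviation P :: "('a \<times> 'a) set set" where
  "P \<equiv> rigid_cofinite_congruences G \<U>"

definition cl :: "('a \<times> 'a) set \<Rightarrow> ('b \<times> 'b) set" where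
  "cl \<rho> = prod_topology T T closure_of (map_prod j j ` \<rho>)"

lemma groupoid: "is_groupoid G"
  and Hausdorff_uniformity: "Hausdorff_uniformity (carrier G) \<U>"
  using cofinite by (simp_all add: cofinite_groupoid_def)

lemmas gr = groupoidD[OF groupoid]

lemma verts_carrier: "v \<in> verts G \<Longrightarrow> v \<in> carrier G"
  using gr(1) by auto

lemma top: "topological_digraph \<Gamma> T" and compact: "compact_space T" and Hausdorff: "Hausdorff_space T"
  and compatible: "compatible_uniformity T \<V>" and hom: "digraph_hom G \<Gamma> j"
  and inj: "inj_on j (carrier G)"
  and closure_range: "T closure_of (j ` carrier G) = carrier \<Gamma>"
  and induced: "\<U> = induced_uniformity (carrier G) j \<V>"
  using completion by (simp_all add: is_completion_def)

lemma topspace: "topspace T = carrier \<Gamma>"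
  using top by (simp add: topological_digraph_def)

lemma uniformity: "uniformity_on (carrier \<Gamma>) \<V>"
  using compatible by (simp add: compatible_uniformity_def topspace)

lemma \<Gamma>_digraph:
  shows "verts \<Gamma> \<subseteq> carrier \<Gamma>"
    and "x \<in> carrier \<Gamma> \<Longrightarrow> src \<Gamma> x \<in> verts \<Gamma>"
    and "x \<in> carrier \<Gamma> \<Longrightarrow> tgt \<Gamma> x \<in> verts \<Gamma>"
    and "v \<in> verts \<Gamma> \<Longrightarrow> src \<Gamma> v = v"
    and "v \<in> verts \<Gamma> \<Longrightarrow> tgt \<Gamma> v = v"
  using top by (auto simp: topological_digraph_def is_digraph_def)

lemma \<Gamma>_verts_carrier: "v \<in> verts \<Gamma> \<Longrightarrow> v \<in> carrier \<Gamma>"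
  using \<Gamma>_digraph(1) by auto

lemma continuous_src: "continuous_map T T (src \<Gamma>)"
  and continuous_tgt: "continuous_map T T (tgt \<Gamma>)"
  using top by (auto simp: topological_digraph_def continuous_map_in_subtopology)

lemma j_carrier: "g \<in> carrier G \<Longrightarrow> j g \<in> carrier \<Gamma>"
  and j_src: "g \<in> carrier G \<Longrightarrow> src \<Gamma> (j g) = j (src G g)"
  and j_tgt: "g \<in> carrier G \<Longrightarrow> tgt \<Gamma> (j g) = j (tgt G g)"
  using hom by (auto simp: digraph_hom_def)

lemma j_eq_iff: "g \<in> carrier G \<Longrightarrow> h \<in> carrier G \<Longrightarrow> j g = j h \<longleftrightarrow> g = h"
  using inj by (auto simp: inj_on_def)

lemma entourage_iff:
  "entourage \<U> E \<longleftrightarrow>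
    (\<exists>D. entourage \<V> D \<and> (\<forall>g\<in>carrier G. \<forall>h\<in>carrier G. (j g, j h) \<in> D \<longrightarrow> (g, h) \<in> E))"
  (is "_ \<longleftrightarrow> ?rhs")
proof -
  have "entourage \<U> E \<longleftrightarrow> (\<exists>Q. eventually Q \<V> \<and>
      (\<forall>g h. Q (j g, j h) \<longrightarrow> g \<in> carrier G \<longrightarrow> h \<in> carrier G \<longrightarrow> (g, h) \<in> E))"
    unfolding entourage_def induced induced_uniformity_def
    by (auto simp: eventually_inf_principal eventually_filtercomap)
  also have "\<dots> \<longleftrightarrow> ?rhs"
  proof
    assume "\<exists>Q. eventually Q \<V> \<and>
      (\<forall>g h. Q (j g, j h) \<longrightarrow> g \<in> carrier G \<longrightarrow> h \<in> carrier G \<longrightarrow> (g, h) \<in> E)"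
    then obtain Q where "eventually Q \<V>"
      "\<And>g h. Q (j g, j h) \<Longrightarrow> g \<in> carrier G \<Longrightarrow> h \<in> carrier G \<Longrightarrow> (g, h) \<in> E" by blast
    then show ?rhs by (intro exI[of _ "Collect Q"]) (auto simp: entourage_def)
  next
    assume ?rhs
    then obtain D where "entourage \<V> D"
      "\<And>g h. g \<in> carrier G \<Longrightarrow> h \<in> carrier G \<Longrightarrow> (j g, j h) \<in> D \<Longrightarrow> (g, h) \<in> E" by blast
    then show "\<exists>Q. eventually Q \<V> \<and>
        (\<forall>g h. Q (j g, j h) \<longrightarrow> g \<in> carrier G \<longrightarrow> h \<in> carrier G \<longrightarrow> (g, h) \<in> E)"
      by (intro exI[of _ "\<lambda>p. p \<in> D"]) (auto simp: entourage_def)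
  qed
  finally show ?thesis .
qed

lemma dense:
  assumes "openin T W" "x \<in> W"
  obtains g where "g \<in> carrier G" "j g \<in> W"
  using closure_range assms unfolding topspace[symmetric] dense_intersects_open by blast

lemma P_D:
  assumes "\<rho> \<in> P"
  shows "congruence G \<rho>" "rigid G \<rho>" "finite (carrier G // \<rho>)" "entourage \<U> \<rho>"
    "equiv (carrier G) \<rho>"
  using assms
  by (auto simp: rigid_cofinite_congruences_def cofinite_congruence_def congruence_def)

text \<open>The set \<open>F\<close> of pairs of distinct vertices is finite, and the Hausdorff
  property gives for each of them an entourage avoiding it; their finite intersection avoids all of
  \<open>F\<close>. A cofinite congruence inside it and inside \<open>E\<close> is then
  rigid.\<close>

lemma rigid_refinement:
  assumes "entourage \<U> E"
  obtains \<rho> where "\<rho> \<in> P" "\<rho> \<subseteq> E"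
proof -
  define F where "F = verts G \<times> verts G - Id"
  have "\<forall>\<^sub>F p in \<U>. \<forall>q\<in>F. p \<noteq> q"
  proof (rule eventually_ball_finite)
    show "finite F" using finite_verts by (simp add: F_def)
    show "\<forall>q\<in>F. \<forall>\<^sub>F p in \<U>. p \<noteq> q"
    proof
      fix q assume "q \<in> F"
      then obtain u v where q: "q = (u, v)" "u \<in> carrier G" "v \<in> carrier G" "u \<noteq> v"
        using verts_carrier by (auto simp: F_def)
      then obtain D where "entourage \<U> D" "(u, v) \<notin> D"
        using Hausdorff_uniformity unfolding Hausdorff_uniformity_def by blast
      then show "\<forall>\<^sub>F p in \<U>. p \<noteq> q"
        unfolding entourage_def by (auto simp: q elim!: eventually_mono)
    qed
  qed
  then have "entourage \<U> (- F)"
    unfolding entourage_def by (rule eventually_mono) auto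
  then obtain \<rho> where \<rho>: "cofinite_congruence G \<U> \<rho>" "\<rho> \<subseteq> E \<inter> - F"
    using cofinite entourage_Int[OF assms] unfolding cofinite_groupoid_def by meson
  have "equiv (carrier G) \<rho>"
    using \<rho>(1) by (simp add: cofinite_congruence_def congruence_def)
  then have "rigid G \<rho>"
    using \<rho>(2) verts_carrier equiv_reflD[of "carrier G" \<rho>] by (auto simp: rigid_def F_def)
  then show thesis
    using \<rho> by (intro that[of \<rho>]) (auto simp: rigid_cofinite_congruences_def)
qed

lemma P_nonempty: "P \<noteq> {}"
proof -
  have "entourage \<U> UNIV" by (simp add: entourage_def)
  then show ?thesis by (rule rigid_refinement) auto
qed

section \<open>The closures as equivalence relations forming a base of the uniformity\<close>

lemma in_cl:
  "(x, y) \<in> cl \<rho> \<longleftrightarrow> x \<in> carrier \<Gamma> \<and> y \<in> carrier \<Gamma> \<and>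
    (\<forall>A B. openin T A \<longrightarrow> openin T B \<longrightarrow> x \<in> A \<longrightarrow> y \<in> B \<longrightarrow>
      (\<exists>g h. (g, h) \<in> \<rho> \<and> j g \<in> A \<and> j h \<in> B))" (is "?lhs \<longleftrightarrow> ?rhs")
proof
  assume l: ?lhs
  have "\<exists>g h. (g, h) \<in> \<rho> \<and> j g \<in> A \<and> j h \<in> B"
    if "openin T A" "openin T B" "x \<in> A" "y \<in> B" for A B
  proof -
    have "(x, y) \<in> A \<times> B \<and> openin (prod_topology T T) (A \<times> B)"
      using that by (simp add: openin_prod_Times_iff)
    then obtain p where "p \<in> map_prod j j ` \<rho>" "p \<in> A \<times> B"
      using l unfolding cl_def in_closure_of by meson
    then show ?thesis by auto
  qed
  then show ?rhs
    using l by (auto simp: cl_def in_closure_of topspace)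
next
  assume r: ?rhs
  show ?lhs
    unfolding cl_def in_closure_of
  proof (intro conjI allI impI)
    show "(x, y) \<in> topspace (prod_topology T T)" using r by (simp add: topspace)
    fix W assume "(x, y) \<in> W \<and> openin (prod_topology T T) W"
    then obtain A B where "openin T A" "openin T B" "x \<in> A" "y \<in> B" and sub: "A \<times> B \<subseteq> W"
      unfolding openin_prod_topology_alt by metis
    then obtain g h where "(g, h) \<in> \<rho>" "j g \<in> A" "j h \<in> B" using r by blast
    then show "\<exists>p. p \<in> map_prod j j ` \<rho> \<and> p \<in> W"
      using sub by (intro exI[of _ "(j g, j h)"]) auto
  qed
qed

lemma in_clE:
  assumes "(x, y) \<in> cl \<rho>" "openin T A" "openin T B" "x \<in> A" "y \<in> B"
  obtains g h where "(g, h) \<in> \<rho>" "j g \<in> A" "j h \<in> B"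
  using assms unfolding in_cl by blast

lemma cl_mono: "\<rho> \<subseteq> \<sigma> \<Longrightarrow> cl \<rho> \<subseteq> cl \<sigma>"
  unfolding cl_def by (intro closure_of_mono image_mono)

text \<open>Around any point of the completion, also outside the image of \<open>j\<close>, the
  class modulo \<open>\<rho>\<close> is locally constant on \<open>G\<close>. The neighbourhood is a
  slice of a symmetric half of an entourage inducing \<open>\<rho>\<close>, so that
  \<open>j g\<close> reaches \<open>j h\<close> through \<open>x\<close>.\<close>

lemma P_nhd:
  assumes "\<rho> \<in> P" "x \<in> carrier \<Gamma>"
  obtains W where "openin T W" "x \<in> W"
    "\<And>g h. g \<in> carrier G \<Longrightarrow> h \<in> carrier G \<Longrightarrow> j g \<in> W \<Longrightarrow> j h \<in> W \<Longrightarrow> (g, h) \<in> \<rho>"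
proof -
  obtain D where D: "entourage \<V> D"
      "\<And>g h. g \<in> carrier G \<Longrightarrow> h \<in> carrier G \<Longrightarrow> (j g, j h) \<in> D \<Longrightarrow> (g, h) \<in> \<rho>"
    using P_D(4)[OF assms(1)] unfolding entourage_iff by blast
  obtain D' where D': "entourage \<V> D'" "D' O D' \<subseteq> D"
    using uniformity_on_entourageD(3)[OF uniformity D(1)] by blast
  have "entourage \<V> (D' \<inter> D'\<inverse>)"
    using D'(1) uniformity_on_entourageD(2)[OF uniformity] by (intro entourage_Int) auto
  then obtain W where "openin T W" "x \<in> W" and W: "\<And>y. y \<in> W \<Longrightarrow> (x, y) \<in> D' \<inter> D'\<inverse>"
    using compatible_uniformity_nhd[OF compatible, of "D' \<inter> D'\<inverse>" x] assms(2) topspace by blast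
  moreover have "(g, h) \<in> \<rho>"
    if "g \<in> carrier G" "h \<in> carrier G" "j g \<in> W" "j h \<in> W" for g h
    using that W D'(2) by (intro D(2)) auto
  ultimately show thesis using that by blast
qed

text \<open>Approximants of \<open>j g\<close> and \<open>j h\<close> that lie close enough are
  \<open>\<rho>\<close>-related to \<open>g\<close> and \<open>h\<close> themselves, so a related
  pair of approximants relates \<open>g\<close> to \<open>h\<close>. Hence taking the closure adds
  no pairs over \<open>G\<close>.\<close>

lemma cl_j:
  assumes "\<rho> \<in> P" "g \<in> carrier G" "h \<in> carrier G"
  shows "(j g, j h) \<in> cl \<rho> \<longleftrightarrow> (g, h) \<in> \<rho>"
proof
  assume "(g, h) \<in> \<rho>"
  then show "(j g, j h) \<in> cl \<rho>"
    unfolding in_cl using assms j_carrier by blast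
next
  assume l: "(j g, j h) \<in> cl \<rho>"
  note eq = P_D(5)[OF assms(1)]
  obtain A where A: "openin T A" "j g \<in> A"
    "\<And>g h. g \<in> carrier G \<Longrightarrow> h \<in> carrier G \<Longrightarrow> j g \<in> A \<Longrightarrow> j h \<in> A \<Longrightarrow> (g, h) \<in> \<rho>"
    using P_nhd[OF assms(1) j_carrier[OF assms(2)]] by blast
  obtain B where B: "openin T B" "j h \<in> B"
    "\<And>g h. g \<in> carrier G \<Longrightarrow> h \<in> carrier G \<Longrightarrow> j g \<in> B \<Longrightarrow> j h \<in> B \<Longrightarrow> (g, h) \<in> \<rho>"
    using P_nhd[OF assms(1) j_carrier[OF assms(3)]] by blast
  obtain g' h' where g'h': "(g', h') \<in> \<rho>" "j g' \<in> A" "j h' \<in> B"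
    using in_clE[OF l A(1) B(1) A(2) B(2)] .
  then have "g' \<in> carrier G" "h' \<in> carrier G" using equiv_type[OF eq] by auto
  then have "(g, g') \<in> \<rho>" "(h', h) \<in> \<rho>"
    using A B g'h' assms by auto
  then show "(g, h) \<in> \<rho>"
    using g'h'(1) equiv_transD[OF eq] by blast
qed

text \<open>Only transitivity is delicate, as the closure of a transitive relation need not be
  transitive: the middle point \<open>y\<close> is approximated by two different elements
  \<open>h\<close> and \<open>h'\<close>. They are related because both lie in a neighbourhood from
  \<open>P_nhd\<close>.\<close>

lemma equiv_cl:
  assumes "\<rho> \<in> P"
  shows "equiv (carrier \<Gamma>) (cl \<rho>)"
proof -
  note eq = P_D(5)[OF assms]
  have "refl_on (carrier \<Gamma>) (cl \<rho>)"
  proof (rule refl_onI)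
    fix x assume x: "x \<in> carrier \<Gamma>"
    have "\<exists>g h. (g, h) \<in> \<rho> \<and> j g \<in> A \<and> j h \<in> B"
      if "openin T A" "openin T B" "x \<in> A" "x \<in> B" for A B
      using dense[of "A \<inter> B" x] that equiv_reflD[OF eq] by blast
    then show "(x, x) \<in> cl \<rho>" using x by (simp add: in_cl)
  qed
  moreover have "sym (cl \<rho>)"
    using equiv_symD[OF eq] unfolding sym_def in_cl by meson
  moreover have "trans (cl \<rho>)"
  proof (rule transI)
    fix x y z assume xy: "(x, y) \<in> cl \<rho>" and yz: "(y, z) \<in> cl \<rho>"
    then have car: "x \<in> carrier \<Gamma>" "y \<in> carrier \<Gamma>" "z \<in> carrier \<Gamma>" by (auto simp: in_cl)
    obtain W where W: "openin T W" "y \<in> W"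
      "\<And>g h. g \<in> carrier G \<Longrightarrow> h \<in> carrier G \<Longrightarrow> j g \<in> W \<Longrightarrow> j h \<in> W \<Longrightarrow> (g, h) \<in> \<rho>"
      using P_nhd[OF assms car(2)] by blast
    have "\<exists>g h. (g, h) \<in> \<rho> \<and> j g \<in> A \<and> j h \<in> B"
      if o: "openin T A" "openin T B" "x \<in> A" "z \<in> B" for A B
    proof -
      obtain g h where gh: "(g, h) \<in> \<rho>" "j g \<in> A" "j h \<in> W"
        using in_clE[OF xy o(1) W(1) o(3) W(2)] .
      obtain h' k where hk: "(h', k) \<in> \<rho>" "j h' \<in> W" "j k \<in> B"
        using in_clE[OF yz W(1) o(2) W(2) o(4)] .
      have "(h, h') \<in> \<rho>"
        using W(3) gh hk equiv_type[OF eq] by auto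
      then have "(g, k) \<in> \<rho>"
        using gh(1) hk(1) equiv_transD[OF eq] by blast
      then show ?thesis using gh hk by blast
    qed
    then show "(x, z) \<in> cl \<rho>" using car by (simp add: in_cl)
  qed
  ultimately show ?thesis
    by (auto simp: equiv_def in_cl)
qed

text \<open>For \<open>D\<close>-close \<open>x\<close> and \<open>y\<close>, nearby elements of
  \<open>G\<close> are joined by the chain \<open>j g\<close>, \<open>x\<close>, \<open>y\<close>,
  \<open>j h\<close> of three \<open>D\<close>-steps. They are therefore \<open>E\<close>-close and
  so related by \<open>\<rho>\<close>, which puts \<open>(x, y)\<close> in the closure.\<close>

lemma entourage_cl:
  assumes "\<rho> \<in> P"
  shows "entourage \<V> (cl \<rho>)"
proof -
  obtain E where E: "entourage \<V> E"
      "\<And>g h. g \<in> carrier G \<Longrightarrow> h \<in> carrier G \<Longrightarrow> (j g, j h) \<in> E \<Longrightarrow> (g, h) \<in> \<rho>"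
    using P_D(4)[OF assms(1)] unfolding entourage_iff by blast
  obtain D where D: "entourage \<V> D" "D \<subseteq> carrier \<Gamma> \<times> carrier \<Gamma>"
    "\<And>x y. (x, y) \<in> D \<Longrightarrow> (y, x) \<in> D"
    "\<And>x y z w. (x, y) \<in> D \<Longrightarrow> (y, z) \<in> D \<Longrightarrow> (z, w) \<in> D \<Longrightarrow> (x, w) \<in> E"
    using uniformity_on_third[OF uniformity E(1)] by blast
  have "(x, y) \<in> cl \<rho>" if xy: "(x, y) \<in> D" for x y
  proof -
    have car: "x \<in> topspace T" "y \<in> topspace T" using xy D(2) topspace by auto
    obtain M where M: "openin T M" "x \<in> M" "\<And>z. z \<in> M \<Longrightarrow> (x, z) \<in> D"
      using compatible_uniformity_nhd[OF compatible D(1) car(1)] by blast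
    obtain N where N: "openin T N" "y \<in> N" "\<And>z. z \<in> N \<Longrightarrow> (y, z) \<in> D"
      using compatible_uniformity_nhd[OF compatible D(1) car(2)] by blast
    have "\<exists>g h. (g, h) \<in> \<rho> \<and> j g \<in> A \<and> j h \<in> B"
      if o: "openin T A" "openin T B" "x \<in> A" "y \<in> B" for A B
    proof -
      obtain g where g: "g \<in> carrier G" "j g \<in> A \<inter> M"
        using dense[of "A \<inter> M" x] o M by blast
      obtain h where h: "h \<in> carrier G" "j h \<in> B \<inter> N"
        using dense[of "B \<inter> N" y] o N by blast
      have "(j g, j h) \<in> E"
        using D(3,4) M(3) N(3) xy g h by blast
      then show ?thesis using E(2) g h by blast
    qed
    then show ?thesis using car topspace by (simp add: in_cl)
  qed
  then have "D \<subseteq> cl \<rho>" by auto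
  then show ?thesis using D(1) entourage_mono by blast
qed

text \<open>Now the chain is \<open>x\<close>, \<open>j g\<close>, \<open>j h\<close>,
  \<open>y\<close>, whose middle step comes from \<open>\<rho>\<close>, chosen inside the pullback
  of \<open>D\<close>. Together with \<open>entourage_cl\<close> this makes the closures a base of
  \<open>\<V>\<close>.\<close>

lemma cl_refinement:
  assumes "entourage \<V> E"
  obtains \<rho> where "\<rho> \<in> P" "cl \<rho> \<subseteq> E"
proof -
  obtain D where D: "entourage \<V> D" "D \<subseteq> carrier \<Gamma> \<times> carrier \<Gamma>"
    "\<And>x y. (x, y) \<in> D \<Longrightarrow> (y, x) \<in> D"
    "\<And>x y z w. (x, y) \<in> D \<Longrightarrow> (y, z) \<in> D \<Longrightarrow> (z, w) \<in> D \<Longrightarrow> (x, w) \<in> E"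
    using uniformity_on_third[OF uniformity assms] by blast
  have "entourage \<U> {(g, h). (j g, j h) \<in> D}"
    unfolding entourage_iff using D(1) by blast
  then obtain \<rho> where \<rho>: "\<rho> \<in> P" "\<rho> \<subseteq> {(g, h). (j g, j h) \<in> D}"
    by (rule rigid_refinement)
  have "(x, y) \<in> E" if xy: "(x, y) \<in> cl \<rho>" for x y
  proof -
    have car: "x \<in> topspace T" "y \<in> topspace T" using xy topspace by (auto simp: in_cl)
    obtain M where M: "openin T M" "x \<in> M" "\<And>z. z \<in> M \<Longrightarrow> (x, z) \<in> D"
      using compatible_uniformity_nhd[OF compatible D(1) car(1)] by blast
    obtain N where N: "openin T N" "y \<in> N" "\<And>z. z \<in> N \<Longrightarrow> (y, z) \<in> D"
      using compatible_uniformity_nhd[OF compatible D(1) car(2)] by blast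
    obtain g h where "(g, h) \<in> \<rho>" "j g \<in> M" "j h \<in> N"
      using in_clE[OF xy M(1) N(1) M(2) N(2)] .
    then show ?thesis
      using D(3)[of y "j h"] D(4)[of x "j g" "j h" y] M(3) N(3) \<rho>(2) by auto
  qed
  then have "cl \<rho> \<subseteq> E" by auto
  then show thesis using \<rho>(1) that by blast
qed

section \<open>Approximation and limits modulo the closures\<close>

lemma openin_cl: "\<rho> \<in> P \<Longrightarrow> openin T (cl \<rho> `` {x})"
  using openin_entourage_class[OF compatible] equiv_cl entourage_cl topspace by metis

lemma cl_base:
  assumes "openin T W" "x \<in> W"
  obtains \<rho> where "\<rho> \<in> P" "cl \<rho> `` {x} \<subseteq> W"
proof -
  obtain \<rho> where "\<rho> \<in> P" "cl \<rho> \<subseteq> {(a, b). a = x \<longrightarrow> b \<in> W}"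
    by (rule cl_refinement[OF compatible_uniformity_openinD[OF compatible assms]])
  then show thesis by (intro that[of \<rho>]) auto
qed

lemma cl_separates:
  assumes "x \<in> carrier \<Gamma>" "y \<in> carrier \<Gamma>" and all: "\<And>\<rho>. \<rho> \<in> P \<Longrightarrow> (x, y) \<in> cl \<rho>"
  shows "x = y"
proof (rule ccontr)
  assume "x \<noteq> y"
  then obtain W where "openin T W" "x \<in> W" "y \<notin> W"
    using Hausdorff assms(1,2) topspace unfolding Hausdorff_space_def disjnt_iff by metis
  then show False
    using cl_base[of W x] all by blast
qed

text \<open>Classes are open and contain \<open>x\<close>, so density puts an element of
  \<open>G\<close> into each.\<close>

lemma cl_approx:
  assumes "\<rho> \<in> P" "x \<in> carrier \<Gamma>"
  obtains g where "g \<in> carrier G" "(x, j g) \<in> cl \<rho>"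
  using dense[OF openin_cl[OF assms(1)], of x x] equiv_reflD[OF equiv_cl[OF assms(1)] assms(2)]
  by blast

text \<open>Having equal sources is a closed condition on pairs, since \<open>T\<close> is Hausdorff
  and \<open>src \<Gamma>\<close> continuous, and it holds on the image of \<open>\<rho>\<close> by
  rigidity; so it passes to the closure. Targets are treated alike.\<close>

lemma cl_src_tgt:
  assumes \<rho>: "\<rho> \<in> P" and xy: "(x, y) \<in> cl \<rho>"
  shows "src \<Gamma> x = src \<Gamma> y" "tgt \<Gamma> x = tgt \<Gamma> y"
proof -
  have "f x = f y" if f: "continuous_map T T f" and "\<And>g h. (g, h) \<in> \<rho> \<Longrightarrow> f (j g) = f (j h)" for f
  proof -
    let ?E = "{p \<in> topspace (prod_topology T T). (f \<circ> fst) p = (f \<circ> snd) p}"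
    have "closedin (prod_topology T T) ?E"
      by (intro closedin_continuous_maps_eq[OF Hausdorff] continuous_map_compose[OF _ f]
          continuous_map_fst continuous_map_snd)
    moreover have "map_prod j j ` \<rho> \<subseteq> ?E"
      using that(2) j_carrier equiv_type[OF P_D(5)[OF \<rho>]] topspace by auto
    ultimately have "cl \<rho> \<subseteq> ?E"
      unfolding cl_def by (intro closure_of_minimal)
    then show ?thesis using xy by auto
  qed
  note * = this
  have "src \<Gamma> (j g) = src \<Gamma> (j h)" "tgt \<Gamma> (j g) = tgt \<Gamma> (j h)" if "(g, h) \<in> \<rho>" for g h
    using rigid_congruence_src_tgt[OF groupoid P_D(1,2)[OF \<rho>] that] j_src j_tgt that
      equiv_type[OF P_D(5)[OF \<rho>]] by auto
  then show "src \<Gamma> x = src \<Gamma> y" "tgt \<Gamma> x = tgt \<Gamma> y"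
    using *[OF continuous_src] *[OF continuous_tgt] by auto
qed

lemma verts_completion: "verts \<Gamma> = j ` verts G"
proof
  have "closedin T (j ` verts G)"
    using finite_verts verts_carrier j_carrier topspace
    by (intro closedin_Hausdorff_finite[OF Hausdorff]) auto
  then have "closedin T {x \<in> topspace T. src \<Gamma> x \<in> j ` verts G}"
    by (rule closedin_continuous_map_preimage[OF continuous_src])
  moreover have "j ` carrier G \<subseteq> {x \<in> topspace T. src \<Gamma> x \<in> j ` verts G}"
    using j_carrier j_src gr(2) topspace by auto
  ultimately have "T closure_of (j ` carrier G) \<subseteq> {x \<in> topspace T. src \<Gamma> x \<in> j ` verts G}"
    by (intro closure_of_minimal)
  then show "verts \<Gamma> \<subseteq> j ` verts G"
    using \<Gamma>_digraph(4) \<Gamma>_verts_carrier unfolding closure_range by force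
  show "j ` verts G \<subseteq> verts \<Gamma>"
    using j_src verts_carrier gr(5) \<Gamma>_digraph(2) j_carrier by (metis image_subsetI)
qed

text \<open>The sets \<open>A \<rho>\<close> form a Cauchy filter base, so this is the completeness of \<open>\<Gamma>\<close>.\<close>

lemma cl_limit:
  assumes ne: "\<And>\<rho>. \<rho> \<in> P \<Longrightarrow> A \<rho> \<noteq> {}"
    and sub: "\<And>\<rho>. \<rho> \<in> P \<Longrightarrow> A \<rho> \<times> A \<rho> \<subseteq> \<rho>"
    and mono: "\<And>\<rho> \<sigma>. \<rho> \<in> P \<Longrightarrow> \<sigma> \<in> P \<Longrightarrow> \<rho> \<subseteq> \<sigma> \<Longrightarrow> A \<rho> \<subseteq> A \<sigma>"
  shows "\<exists>z\<in>carrier \<Gamma>. \<forall>\<rho>\<in>P. \<forall>g\<in>A \<rho>. (z, j g) \<in> cl \<rho>"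
proof -
  define K where "K = (\<lambda>\<rho>. {z \<in> carrier \<Gamma>. \<forall>g\<in>A \<rho>. (z, j g) \<in> cl \<rho>})"
  have car: "g \<in> carrier G" if "\<rho> \<in> P" "g \<in> A \<rho>" for \<rho> g
    using sub[OF that(1)] that equiv_type[OF P_D(5)[OF that(1)]] by blast
  \<comment> \<open>By \<open>sub\<close> all elements of \<open>A \<rho>\<close> lie in one class,
    so closeness to one of them is closeness to all. Thus \<open>K \<rho>\<close> is a class of the
    closure, nonempty and closed.\<close>
  have K: "K \<rho> = cl \<rho> `` {j g}" if \<rho>: "\<rho> \<in> P" and g: "g \<in> A \<rho>" for \<rho> g
  proof -
    note eq = equiv_cl[OF \<rho>]
    have near: "(j g, j h) \<in> cl \<rho>" if "h \<in> A \<rho>" for h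
      using cl_j[OF \<rho>] sub[OF \<rho>] car[OF \<rho>] g that by blast
    have "z \<in> K \<rho> \<longleftrightarrow> (j g, z) \<in> cl \<rho>" for z
    proof
      assume "z \<in> K \<rho>"
      then show "(j g, z) \<in> cl \<rho>" using g equiv_symD[OF eq] by (auto simp: K_def)
    next
      assume z: "(j g, z) \<in> cl \<rho>"
      then have "(z, j h) \<in> cl \<rho>" if "h \<in> A \<rho>" for h
        using near[OF that] equiv_symD[OF eq] equiv_transD[OF eq] by blast
      then show "z \<in> K \<rho>" using z by (auto simp: K_def in_cl)
    qed
    then show ?thesis by auto
  qed
  have K_ne: "K \<rho> \<noteq> {}" and K_closed: "closedin T (K \<rho>)" if \<rho>: "\<rho> \<in> P" for \<rho>
  proof -
    obtain g where g: "g \<in> A \<rho>" using ne[OF \<rho>] by blast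
    show "K \<rho> \<noteq> {}"
      using K[OF \<rho> g] equiv_reflD[OF equiv_cl[OF \<rho>] j_carrier[OF car[OF \<rho> g]]] by blast
    show "closedin T (K \<rho>)"
      using K[OF \<rho> g] closedin_equiv_class[of T "cl \<rho>"] equiv_cl[OF \<rho>] openin_cl[OF \<rho>] topspace
      by simp
  qed
  have K_mono: "K \<rho> \<subseteq> K \<sigma>" if m: "\<rho> \<in> P" "\<sigma> \<in> P" "\<rho> \<subseteq> \<sigma>" for \<rho> \<sigma>
  proof -
    obtain g where g: "g \<in> A \<rho>" using ne[OF m(1)] by blast
    then have "g \<in> A \<sigma>" using mono[OF m] by blast
    then show ?thesis
      using K[OF m(1) g] K[OF m(2)] cl_mono[OF m(3)] by auto
  qed
  have K_dir: "\<exists>\<tau>\<in>P. K \<tau> \<subseteq> K \<rho> \<inter> K \<sigma>" if m: "\<rho> \<in> P" "\<sigma> \<in> P" for \<rho> \<sigma>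
    using rigid_cofinite_congruences_Int[OF m] K_mono[OF rigid_cofinite_congruences_Int[OF m] m(1)] K_mono[OF rigid_cofinite_congruences_Int[OF m] m(2)]
    by (intro bexI[of _ "\<rho> \<inter> \<sigma>"]) auto
  obtain z where "z \<in> topspace T" "\<And>\<rho>. \<rho> \<in> P \<Longrightarrow> z \<in> K \<rho>"
    using compact_space_directed_closed[OF compact P_nonempty K_closed K_ne K_dir] by blast
  then show ?thesis by (auto simp: K_def topspace)
qed

section \<open>The groupoid structure on the completion\<close>

text \<open>Within a class of \<open>cl \<rho>\<close> sources and targets do not move at all, so
  the approximants match exactly and not only up to \<open>\<rho>\<close>; injectivity of
  \<open>j\<close> brings the equality back to \<open>G\<close>.\<close>

lemma composable_approx:
  assumes xy: "(x, y) \<in> composable \<Gamma>" and \<rho>: "\<rho> \<in> P"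
    and g: "g \<in> carrier G" "(x, j g) \<in> cl \<rho>" and h: "h \<in> carrier G" "(y, j h) \<in> cl \<rho>"
  shows "(g, h) \<in> composable G"
proof -
  have "j (tgt G g) = j (src G h)"
    using xy cl_src_tgt[OF \<rho> g(2)] cl_src_tgt[OF \<rho> h(2)] j_src[OF h(1)] j_tgt[OF g(1)]
    by (simp add: composable_def)
  then have "tgt G g = src G h"
    using j_eq_iff gr(2,3) verts_carrier g(1) h(1) by blast
  then show ?thesis using g(1) h(1) by (simp add: composable_def)
qed

lemma composable_j:
  assumes "g \<in> carrier G" "h \<in> carrier G"
  shows "(j g, j h) \<in> composable \<Gamma> \<longleftrightarrow> (g, h) \<in> composable G"
proof -
  have "j (tgt G g) = j (src G h) \<longleftrightarrow> tgt G g = src G h"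
    using j_eq_iff gr(2,3) verts_carrier assms by blast
  then show ?thesis
    using assms by (simp add: composable_def j_carrier j_src j_tgt)
qed

text \<open>For composable arguments exactly one point meets the condition: existence is a limit
  argument, and two such points agree modulo every \<open>cl \<rho>\<close>. For other arguments no
  composable approximants exist, the condition is vacuous and the value carries no meaning.\<close>

definition completion_mult :: "'b \<Rightarrow> 'b \<Rightarrow> 'b" where
  "completion_mult x y = (SOME z. z \<in> carrier \<Gamma> \<and>
     (\<forall>\<rho>\<in>P. \<forall>(g, h)\<in>composable G.
        (x, j g) \<in> cl \<rho> \<longrightarrow> (y, j h) \<in> cl \<rho> \<longrightarrow> (z, j (gmult G g h)) \<in> cl \<rho>))"

definition completion_inv :: "'b \<Rightarrow> 'b" where
  "completion_inv x = (SOME z. z \<in> carrier \<Gamma> \<and>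
     (\<forall>\<rho>\<in>P. \<forall>g\<in>carrier G. (x, j g) \<in> cl \<rho> \<longrightarrow> (z, j (ginv G g)) \<in> cl \<rho>))"

definition completion_groupoid :: "'b groupoid" where
  "completion_groupoid =
     \<lparr>carrier = carrier \<Gamma>, verts = verts \<Gamma>, src = src \<Gamma>, tgt = tgt \<Gamma>,
      gmult = completion_mult, ginv = completion_inv\<rparr>"

lemma completion_groupoid_simps [simp]:
  "carrier completion_groupoid = carrier \<Gamma>"
  "verts completion_groupoid = verts \<Gamma>"
  "src completion_groupoid = src \<Gamma>"
  "tgt completion_groupoid = tgt \<Gamma>"
  "gmult completion_groupoid = completion_mult"
  "ginv completion_groupoid = completion_inv"
  "composable completion_groupoid = composable \<Gamma>"
  "digraph.truncate completion_groupoid = \<Gamma>"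
  by (simp_all add: completion_groupoid_def composable_def digraph.truncate_def)

lemma cl_eq_j:
  assumes "\<rho> \<in> P" "(x, j g) \<in> cl \<rho>" "(x, j h) \<in> cl \<rho>" "g \<in> carrier G" "h \<in> carrier G"
  shows "(g, h) \<in> \<rho>"
  using assms cl_j equiv_symD[OF equiv_cl] equiv_transD[OF equiv_cl] by metis

text \<open>The sets \<open>A \<rho>\<close> of products of approximants modulo
  \<open>\<rho>\<close> meet the conditions of \<open>cl_limit\<close>: approximants exist and
  compose, any two choices of them are related modulo \<open>\<rho>\<close> and so are their
  products, and a finer \<open>\<rho>\<close> admits fewer approximants.\<close>

lemma completion_mult:
  assumes xy: "(x, y) \<in> composable \<Gamma>"
  shows "completion_mult x y \<in> carrier \<Gamma>"
    and "\<rho> \<in> P \<Longrightarrow> g \<in> carrier G \<Longrightarrow> h \<in> carrier G \<Longrightarrow> (x, j g) \<in> cl \<rho> \<Longrightarrow> (y, j h) \<in> cl \<rho> \<Longrightarrow>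
        (completion_mult x y, j (gmult G g h)) \<in> cl \<rho>"
proof -
  have car: "x \<in> carrier \<Gamma>" "y \<in> carrier \<Gamma>" using xy by (auto simp: composable_def)
  define A where "A = (\<lambda>\<rho>. {gmult G g h | g h. (g, h) \<in> composable G \<and>
      (x, j g) \<in> cl \<rho> \<and> (y, j h) \<in> cl \<rho>})"
  have ne: "A \<rho> \<noteq> {}" if \<rho>: "\<rho> \<in> P" for \<rho>
  proof -
    obtain g where g: "g \<in> carrier G" "(x, j g) \<in> cl \<rho>" by (rule cl_approx[OF \<rho> car(1)])
    obtain h where h: "h \<in> carrier G" "(y, j h) \<in> cl \<rho>" by (rule cl_approx[OF \<rho> car(2)])
    show ?thesis
      using composable_approx[OF xy \<rho> g h] g h by (auto simp: A_def)
  qed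
  have sub: "A \<rho> \<times> A \<rho> \<subseteq> \<rho>" if \<rho>: "\<rho> \<in> P" for \<rho>
  proof -
    have "(gmult G g h, gmult G g' h') \<in> \<rho>"
      if c: "(g, h) \<in> composable G" "(g', h') \<in> composable G"
        and n: "(x, j g) \<in> cl \<rho>" "(y, j h) \<in> cl \<rho>" "(x, j g') \<in> cl \<rho>" "(y, j h') \<in> cl \<rho>"
      for g h g' h'
    proof (rule congruenceD(5)[OF P_D(1)[OF \<rho>] _ _ c])
      show "(g, g') \<in> \<rho>" "(h, h') \<in> \<rho>"
        using c by (auto simp: composable_def intro: cl_eq_j[OF \<rho> n(1,3)] cl_eq_j[OF \<rho> n(2,4)])
    qed
    then show ?thesis by (auto simp: A_def)
  qed
  have mono: "A \<rho> \<subseteq> A \<sigma>" if "\<rho> \<in> P" "\<sigma> \<in> P" "\<rho> \<subseteq> \<sigma>" for \<rho> \<sigma>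
    using cl_mono[OF that(3)] by (auto simp: A_def)
  obtain z where z: "z \<in> carrier \<Gamma>" "\<And>\<rho> g. \<rho> \<in> P \<Longrightarrow> g \<in> A \<rho> \<Longrightarrow> (z, j g) \<in> cl \<rho>"
    using cl_limit[of A, OF ne sub mono] by blast
  have "z \<in> carrier \<Gamma> \<and> (\<forall>\<rho>\<in>P. \<forall>(g, h)\<in>composable G.
        (x, j g) \<in> cl \<rho> \<longrightarrow> (y, j h) \<in> cl \<rho> \<longrightarrow> (z, j (gmult G g h)) \<in> cl \<rho>)"
    using z by (auto simp: A_def)
  then have *: "completion_mult x y \<in> carrier \<Gamma> \<and> (\<forall>\<rho>\<in>P. \<forall>(g, h)\<in>composable G.
        (x, j g) \<in> cl \<rho> \<longrightarrow> (y, j h) \<in> cl \<rho> \<longrightarrow> (completion_mult x y, j (gmult G g h)) \<in> cl \<rho>)"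
    unfolding completion_mult_def by (rule someI)
  then show "completion_mult x y \<in> carrier \<Gamma>" by simp
  show "(completion_mult x y, j (gmult G g h)) \<in> cl \<rho>"
    if \<rho>: "\<rho> \<in> P" and g: "g \<in> carrier G" and h: "h \<in> carrier G"
      and n: "(x, j g) \<in> cl \<rho>" "(y, j h) \<in> cl \<rho>"
    using * \<rho> n composable_approx[OF xy \<rho> g n(1) h n(2)] by blast
qed

lemma completion_inv:
  assumes x: "x \<in> carrier \<Gamma>"
  shows "completion_inv x \<in> carrier \<Gamma>"
    and "\<rho> \<in> P \<Longrightarrow> g \<in> carrier G \<Longrightarrow> (x, j g) \<in> cl \<rho> \<Longrightarrow> (completion_inv x, j (ginv G g)) \<in> cl \<rho>"
proof -
  define A where "A = (\<lambda>\<rho>. {ginv G g | g. g \<in> carrier G \<and> (x, j g) \<in> cl \<rho>})"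
  have ne: "A \<rho> \<noteq> {}" if \<rho>: "\<rho> \<in> P" for \<rho>
    using cl_approx[OF \<rho> x] by (auto simp: A_def)
  have sub: "A \<rho> \<times> A \<rho> \<subseteq> \<rho>" if \<rho>: "\<rho> \<in> P" for \<rho>
    using congruenceD(4)[OF P_D(1)[OF \<rho>]] cl_eq_j[OF \<rho>] by (auto simp: A_def)
  have mono: "A \<rho> \<subseteq> A \<sigma>" if "\<rho> \<in> P" "\<sigma> \<in> P" "\<rho> \<subseteq> \<sigma>" for \<rho> \<sigma>
    using cl_mono[OF that(3)] by (auto simp: A_def)
  obtain z where z: "z \<in> carrier \<Gamma>" "\<And>\<rho> g. \<rho> \<in> P \<Longrightarrow> g \<in> A \<rho> \<Longrightarrow> (z, j g) \<in> cl \<rho>"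
    using cl_limit[of A, OF ne sub mono] by blast
  have "z \<in> carrier \<Gamma> \<and>
      (\<forall>\<rho>\<in>P. \<forall>g\<in>carrier G. (x, j g) \<in> cl \<rho> \<longrightarrow> (z, j (ginv G g)) \<in> cl \<rho>)"
    using z by (auto simp: A_def)
  then have *: "completion_inv x \<in> carrier \<Gamma> \<and>
      (\<forall>\<rho>\<in>P. \<forall>g\<in>carrier G. (x, j g) \<in> cl \<rho> \<longrightarrow> (completion_inv x, j (ginv G g)) \<in> cl \<rho>)"
    unfolding completion_inv_def by (rule someI)
  then show "completion_inv x \<in> carrier \<Gamma>"
    and "\<rho> \<in> P \<Longrightarrow> g \<in> carrier G \<Longrightarrow> (x, j g) \<in> cl \<rho> \<Longrightarrow> (completion_inv x, j (ginv G g)) \<in> cl \<rho>"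
    by blast+
qed

text \<open>The common neighbour may vary with \<open>\<rho>\<close>. In applications it is the
  image under \<open>j\<close> of an expression evaluated in \<open>G\<close> at
  approximants.\<close>

lemma cl_eqI:
  assumes "x \<in> carrier \<Gamma>" "y \<in> carrier \<Gamma>" "\<And>\<rho>. \<rho> \<in> P \<Longrightarrow> \<exists>z. (x, z) \<in> cl \<rho> \<and> (y, z) \<in> cl \<rho>"
  shows "x = y"
  using assms cl_separates equiv_symD[OF equiv_cl] equiv_transD[OF equiv_cl] by metis

lemma completion_mult_j:
  assumes "(g, h) \<in> composable G"
  shows "completion_mult (j g) (j h) = j (gmult G g h)"
proof -
  have gh: "g \<in> carrier G" "h \<in> carrier G" using assms by (auto simp: composable_def)
  then have c: "(j g, j h) \<in> composable \<Gamma>" using assms composable_j by simp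
  show ?thesis
  proof (rule cl_separates)
    show "completion_mult (j g) (j h) \<in> carrier \<Gamma>" by (rule completion_mult(1)[OF c])
    show "j (gmult G g h) \<in> carrier \<Gamma>" by (intro j_carrier gr(7) assms)
    show "(completion_mult (j g) (j h), j (gmult G g h)) \<in> cl \<rho>" if "\<rho> \<in> P" for \<rho>
      using that gh j_carrier equiv_reflD[OF equiv_cl] by (intro completion_mult(2)[OF c]) auto
  qed
qed

lemma completion_inv_j:
  assumes "g \<in> carrier G"
  shows "completion_inv (j g) = j (ginv G g)"
proof (rule cl_separates)
  show "completion_inv (j g) \<in> carrier \<Gamma>" by (intro completion_inv j_carrier assms)
  show "j (ginv G g) \<in> carrier \<Gamma>" by (intro j_carrier gr(4) assms)
  show "(completion_inv (j g), j (ginv G g)) \<in> cl \<rho>" if "\<rho> \<in> P" for \<rho>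
    using that assms j_carrier equiv_reflD[OF equiv_cl]
    by (intro completion_inv(2)[OF j_carrier[OF assms]]) auto
qed

text \<open>A single \<open>\<rho>\<close> suffices, because \<open>cl_src_tgt\<close> gives
  equality of the ends and not mere closeness.\<close>

lemma completion_mult_src_tgt:
  assumes xy: "(x, y) \<in> composable \<Gamma>"
  shows "src \<Gamma> (completion_mult x y) = src \<Gamma> x" "tgt \<Gamma> (completion_mult x y) = tgt \<Gamma> y"
proof -
  have car: "x \<in> carrier \<Gamma>" "y \<in> carrier \<Gamma>" using xy by (auto simp: composable_def)
  obtain \<rho> where \<rho>: "\<rho> \<in> P" using P_nonempty by blast
  obtain g where g: "g \<in> carrier G" "(x, j g) \<in> cl \<rho>" by (rule cl_approx[OF \<rho> car(1)])
  obtain h where h: "h \<in> carrier G" "(y, j h) \<in> cl \<rho>" by (rule cl_approx[OF \<rho> car(2)])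
  have c: "(g, h) \<in> composable G" by (rule composable_approx[OF xy \<rho> g h])
  have n: "(completion_mult x y, j (gmult G g h)) \<in> cl \<rho>"
    by (rule completion_mult(2)[OF xy \<rho> g(1) h(1) g(2) h(2)])
  show "src \<Gamma> (completion_mult x y) = src \<Gamma> x" "tgt \<Gamma> (completion_mult x y) = tgt \<Gamma> y"
    using cl_src_tgt[OF \<rho> n] cl_src_tgt[OF \<rho> g(2)] cl_src_tgt[OF \<rho> h(2)] gr(7-9)[OF c] g h
    by (simp_all add: j_src j_tgt)
qed

lemma completion_inv_src_tgt:
  assumes x: "x \<in> carrier \<Gamma>"
  shows "src \<Gamma> (completion_inv x) = tgt \<Gamma> x" "tgt \<Gamma> (completion_inv x) = src \<Gamma> x"
proof -
  obtain \<rho> where \<rho>: "\<rho> \<in> P" using P_nonempty by blast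
  obtain g where g: "g \<in> carrier G" "(x, j g) \<in> cl \<rho>" by (rule cl_approx[OF \<rho> x])
  have n: "(completion_inv x, j (ginv G g)) \<in> cl \<rho>"
    by (rule completion_inv(2)[OF x \<rho> g])
  have "src G (ginv G g) = tgt G g" "tgt G (ginv G g) = src G g"
    using groupoid g(1) by (auto simp: is_groupoid_def)
  then show "src \<Gamma> (completion_inv x) = tgt \<Gamma> x" "tgt \<Gamma> (completion_inv x) = src \<Gamma> x"
    using cl_src_tgt[OF \<rho> n] cl_src_tgt[OF \<rho> g(2)] gr(4) g by (simp_all add: j_src j_tgt)
qed

lemma is_groupoid_completion: "is_groupoid completion_groupoid"
proof -
  have "is_digraph completion_groupoid"
    using \<Gamma>_digraph by (auto simp: is_digraph_def)
  moreover have "completion_mult (completion_mult x y) z = completion_mult x (completion_mult y z)"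
    if xy: "(x, y) \<in> composable \<Gamma>" and yz: "(y, z) \<in> composable \<Gamma>" for x y z
  proof -
    have car: "x \<in> carrier \<Gamma>" "y \<in> carrier \<Gamma>" "z \<in> carrier \<Gamma>"
      using xy yz by (auto simp: composable_def)
    have c1: "(completion_mult x y, z) \<in> composable \<Gamma>"
      and c2: "(x, completion_mult y z) \<in> composable \<Gamma>"
      using xy yz completion_mult(1) completion_mult_src_tgt by (auto simp: composable_def)
    show ?thesis
    proof (rule cl_eqI)
      show "completion_mult (completion_mult x y) z \<in> carrier \<Gamma>"
        "completion_mult x (completion_mult y z) \<in> carrier \<Gamma>"
        using completion_mult(1) c1 c2 by auto
      fix \<rho> assume \<rho>: "\<rho> \<in> P"
      obtain g where g: "g \<in> carrier G" "(x, j g) \<in> cl \<rho>" by (rule cl_approx[OF \<rho> car(1)])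
      obtain h where h: "h \<in> carrier G" "(y, j h) \<in> cl \<rho>" by (rule cl_approx[OF \<rho> car(2)])
      obtain k where k: "k \<in> carrier G" "(z, j k) \<in> cl \<rho>" by (rule cl_approx[OF \<rho> car(3)])
      note gh = composable_approx[OF xy \<rho> g h] and hk = composable_approx[OF yz \<rho> h k]
      have "gmult G (gmult G g h) k = gmult G g (gmult G h k)"
        using groupoid gh hk by (simp add: is_groupoid_def)
      moreover have "(completion_mult (completion_mult x y) z, j (gmult G (gmult G g h) k)) \<in> cl \<rho>"
        using g h k gr(7)[OF gh] by (intro completion_mult(2)[OF c1 \<rho>] completion_mult(2)[OF xy \<rho>])
      moreover have "(completion_mult x (completion_mult y z), j (gmult G g (gmult G h k))) \<in> cl \<rho>"
        using g h k gr(7)[OF hk] by (intro completion_mult(2)[OF c2 \<rho>] completion_mult(2)[OF yz \<rho>])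
      ultimately show "\<exists>w. (completion_mult (completion_mult x y) z, w) \<in> cl \<rho> \<and>
          (completion_mult x (completion_mult y z), w) \<in> cl \<rho>" by metis
    qed
  qed
  moreover have "completion_mult (src \<Gamma> x) x = x \<and> completion_mult x (tgt \<Gamma> x) = x \<and>
      completion_mult x (completion_inv x) = src \<Gamma> x \<and>
      completion_mult (completion_inv x) x = tgt \<Gamma> x"
    if x: "x \<in> carrier \<Gamma>" for x
  proof -
    have s: "src \<Gamma> x \<in> carrier \<Gamma>" "tgt \<Gamma> x \<in> carrier \<Gamma>"
      using \<Gamma>_digraph(2,3)[OF x] \<Gamma>_verts_carrier by auto
    have c: "(src \<Gamma> x, x) \<in> composable \<Gamma>" "(x, tgt \<Gamma> x) \<in> composable \<Gamma>"
      "(x, completion_inv x) \<in> composable \<Gamma>" "(completion_inv x, x) \<in> composable \<Gamma>"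
      using x s \<Gamma>_digraph completion_inv_src_tgt[OF x] completion_inv(1)[OF x]
      by (auto simp: composable_def)
    have "(completion_mult (src \<Gamma> x) x, x) \<in> cl \<rho> \<and> (completion_mult x (tgt \<Gamma> x), x) \<in> cl \<rho> \<and>
        (completion_mult x (completion_inv x), src \<Gamma> x) \<in> cl \<rho> \<and>
        (completion_mult (completion_inv x) x, tgt \<Gamma> x) \<in> cl \<rho>" if \<rho>: "\<rho> \<in> P" for \<rho>
    proof -
      obtain g where g: "g \<in> carrier G" "(x, j g) \<in> cl \<rho>" by (rule cl_approx[OF \<rho> x])
      \<comment> \<open>The ends of \<open>x\<close> are not just approximated but equal to those of
        \<open>g\<close>, so the unit laws of \<open>G\<close> at \<open>g\<close> apply to them
        directly.\<close>
      have st: "src \<Gamma> x = j (src G g)" "tgt \<Gamma> x = j (tgt G g)"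
        using cl_src_tgt[OF \<rho> g(2)] g(1) by (simp_all add: j_src j_tgt)
      have vg: "src G g \<in> carrier G" "tgt G g \<in> carrier G"
        using gr(2,3) verts_carrier g(1) by auto
      have refl: "(j (src G g), j (src G g)) \<in> cl \<rho>" "(j (tgt G g), j (tgt G g)) \<in> cl \<rho>"
        using vg j_carrier equiv_reflD[OF equiv_cl[OF \<rho>]] by auto
      have i: "(completion_inv x, j (ginv G g)) \<in> cl \<rho>"
        by (rule completion_inv(2)[OF x \<rho> g])
      have unit: "gmult G (src G g) g = g" "gmult G g (tgt G g) = g"
        "gmult G g (ginv G g) = src G g" "gmult G (ginv G g) g = tgt G g"
        using groupoid g(1) by (auto simp: is_groupoid_def)
      have "(completion_mult (src \<Gamma> x) x, j g) \<in> cl \<rho>"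
        using completion_mult(2)[OF c(1) \<rho> vg(1) g(1)] refl g(2) by (simp add: st unit)
      moreover have "(completion_mult x (tgt \<Gamma> x), j g) \<in> cl \<rho>"
        using completion_mult(2)[OF c(2) \<rho> g(1) vg(2)] refl g(2) by (simp add: st unit)
      moreover have "(completion_mult x (completion_inv x), src \<Gamma> x) \<in> cl \<rho>"
        using completion_mult(2)[OF c(3) \<rho> g(1) gr(4)[OF g(1)] g(2) i] by (simp add: st unit)
      moreover have "(completion_mult (completion_inv x) x, tgt \<Gamma> x) \<in> cl \<rho>"
        using completion_mult(2)[OF c(4) \<rho> gr(4)[OF g(1)] g(1) i g(2)] by (simp add: st unit)
      ultimately show ?thesis
        using g(2) equiv_symD[OF equiv_cl[OF \<rho>]] equiv_transD[OF equiv_cl[OF \<rho>]] by blast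
    qed
    then show ?thesis
      using completion_mult(1)[OF c(1)] completion_mult(1)[OF c(2)] completion_mult(1)[OF c(3)]
        completion_mult(1)[OF c(4)] x s cl_separates by auto
  qed
  ultimately show ?thesis
    unfolding is_groupoid_def
    using completion_mult(1) completion_mult_src_tgt completion_inv(1) completion_inv_src_tgt
    by auto
qed

text \<open>By transitivity approximants of \<open>x'\<close> and \<open>y'\<close> also approximate
  \<open>x\<close> and \<open>y\<close>, so both products are close to one and the same product
  formed in \<open>G\<close>. Inverses are handled in the same way.\<close>

lemma congruence_cl:
  assumes \<rho>: "\<rho> \<in> P"
  shows "congruence completion_groupoid (cl \<rho>)"
  unfolding congruence_iff completion_groupoid_simps
proof (intro conjI allI impI)
  note eq = equiv_cl[OF \<rho>]
  show "equiv (carrier \<Gamma>) (cl \<rho>)" by (rule eq)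
  show "(completion_mult x y, completion_mult x' y') \<in> cl \<rho>"
    if xx: "(x, x') \<in> cl \<rho>" and yy: "(y, y') \<in> cl \<rho>" and c: "(x, y) \<in> composable \<Gamma>"
      and c': "(x', y') \<in> composable \<Gamma>" for x x' y y'
  proof -
    have car: "x' \<in> carrier \<Gamma>" "y' \<in> carrier \<Gamma>" using c' by (auto simp: composable_def)
    obtain g where g: "g \<in> carrier G" "(x', j g) \<in> cl \<rho>" by (rule cl_approx[OF \<rho> car(1)])
    obtain h where h: "h \<in> carrier G" "(y', j h) \<in> cl \<rho>" by (rule cl_approx[OF \<rho> car(2)])
    have "(completion_mult x y, j (gmult G g h)) \<in> cl \<rho>"
      using g h equiv_transD[OF eq xx] equiv_transD[OF eq yy]
      by (intro completion_mult(2)[OF c \<rho>]) auto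
    moreover have "(completion_mult x' y', j (gmult G g h)) \<in> cl \<rho>"
      by (rule completion_mult(2)[OF c' \<rho> g(1) h(1) g(2) h(2)])
    ultimately show ?thesis
      using equiv_symD[OF eq] equiv_transD[OF eq] by blast
  qed
  fix x y assume xy: "(x, y) \<in> cl \<rho>"
  then have car: "x \<in> carrier \<Gamma>" "y \<in> carrier \<Gamma>" by (auto simp: in_cl)
  show "(src \<Gamma> x, src \<Gamma> y) \<in> cl \<rho>" "(tgt \<Gamma> x, tgt \<Gamma> y) \<in> cl \<rho>"
    using cl_src_tgt[OF \<rho> xy] \<Gamma>_digraph(2,3) \<Gamma>_verts_carrier car equiv_reflD[OF eq] by auto
  obtain g where g: "g \<in> carrier G" "(y, j g) \<in> cl \<rho>" by (rule cl_approx[OF \<rho> car(2)])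
  have "(completion_inv x, j (ginv G g)) \<in> cl \<rho>"
    using completion_inv(2)[OF car(1) \<rho> g(1) equiv_transD[OF eq xy g(2)]] .
  moreover have "(completion_inv y, j (ginv G g)) \<in> cl \<rho>"
    by (rule completion_inv(2)[OF car(2) \<rho> g])
  ultimately show "(completion_inv x, completion_inv y) \<in> cl \<rho>"
    using equiv_symD[OF eq] equiv_transD[OF eq] by blast
qed

text \<open>The operations respect each \<open>cl \<rho>\<close>, hence carry classes into classes,
  and the open classes of a point form a neighbourhood base. For the product, boxes of classes are
  cut down to composable pairs.\<close>

lemma continuous_operations_completion: "continuous_operations completion_groupoid T"
  unfolding continuous_operations_def completion_groupoid_simps
proof
  note eq = equiv_cl
  show "continuous_map T T completion_inv"
    unfolding continuous_map_def
  proof (intro conjI allI impI)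
    show "completion_inv \<in> topspace T \<rightarrow> topspace T"
      using completion_inv(1) topspace by auto
    fix W assume W: "openin T W"
    show "openin T {x \<in> topspace T. completion_inv x \<in> W}"
    proof (subst openin_subopen, intro ballI)
      fix x assume "x \<in> {x \<in> topspace T. completion_inv x \<in> W}"
      then have x: "x \<in> carrier \<Gamma>" "completion_inv x \<in> W" using topspace by auto
      obtain \<rho> where \<rho>: "\<rho> \<in> P" "cl \<rho> `` {completion_inv x} \<subseteq> W"
        by (rule cl_base[OF W x(2)])
      have "cl \<rho> `` {x} \<subseteq> {x \<in> topspace T. completion_inv x \<in> W}"
      proof
        fix y assume "y \<in> cl \<rho> `` {x}"
        then have "(completion_inv x, completion_inv y) \<in> cl \<rho>" "y \<in> topspace T"
          using congruenceD(4)[OF congruence_cl[OF \<rho>(1)], of x y] equiv_type[OF eq[OF \<rho>(1)]]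
            topspace by auto
        then show "y \<in> {x \<in> topspace T. completion_inv x \<in> W}" using \<rho>(2) by auto
      qed
      then show "\<exists>A. openin T A \<and> x \<in> A \<and> A \<subseteq> {x \<in> topspace T. completion_inv x \<in> W}"
        using openin_cl[OF \<rho>(1)] equiv_reflD[OF eq[OF \<rho>(1)] x(1)] by blast
    qed
  qed
  let ?C = "subtopology (prod_topology T T) (composable \<Gamma>)"
  have C: "topspace ?C = composable \<Gamma>"
    using topspace by (auto simp: composable_def)
  show "continuous_map ?C T (\<lambda>(x, y). completion_mult x y)"
    unfolding continuous_map_def
  proof (intro conjI allI impI)
    show "(\<lambda>(x, y). completion_mult x y) \<in> topspace ?C \<rightarrow> topspace T"
      unfolding C using completion_mult(1) topspace by auto
    fix W assume W: "openin T W"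
    show "openin ?C {p \<in> topspace ?C. (case p of (x, y) \<Rightarrow> completion_mult x y) \<in> W}" (is "openin _ ?S")
    proof (subst openin_subopen, intro ballI)
      fix p assume p: "p \<in> ?S"
      obtain x y where xy: "p = (x, y)" by (cases p)
      have c: "(x, y) \<in> composable \<Gamma>" and w: "completion_mult x y \<in> W"
        using p xy C by auto
      then have car: "x \<in> carrier \<Gamma>" "y \<in> carrier \<Gamma>" by (auto simp: composable_def)
      obtain \<rho> where \<rho>: "\<rho> \<in> P" "cl \<rho> `` {completion_mult x y} \<subseteq> W"
        by (rule cl_base[OF W w])
      let ?A = "(cl \<rho> `` {x} \<times> cl \<rho> `` {y}) \<inter> composable \<Gamma>"
      have "openin (prod_topology T T) (cl \<rho> `` {x} \<times> cl \<rho> `` {y})"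
        using openin_cl[OF \<rho>(1)] by (simp add: openin_prod_Times_iff)
      then have "openin ?C ?A" by (auto simp: openin_subtopology)
      moreover have "p \<in> ?A"
        using xy c car equiv_reflD[OF eq[OF \<rho>(1)]] by auto
      moreover have "?A \<subseteq> ?S"
        using \<rho>(2) congruenceD(5)[OF congruence_cl[OF \<rho>(1)]] c unfolding C by auto
      ultimately show "\<exists>A. openin ?C A \<and> p \<in> A \<and> A \<subseteq> ?S" by blast
    qed
  qed
qed

text \<open>Two continuous extensions agree on \<open>G\<close>, so density decides. For the
  product, elements of \<open>G\<close> must be found near \<open>x\<close> and \<open>y\<close>
  that in addition compose, since the extension property speaks only about such pairs.\<close>

lemma completion_unique:
  assumes H': "continuous_extension G \<Gamma> T j H'"
  shows "same_operations completion_groupoid H'"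
proof -
  have "digraph.truncate H' = \<Gamma>" and cont: "continuous_operations H' T"
    and inv': "\<And>g. g \<in> carrier G \<Longrightarrow> ginv H' (j g) = j (ginv G g)"
    and mult': "\<And>g h. (g, h) \<in> composable G \<Longrightarrow> gmult H' (j g) (j h) = j (gmult G g h)"
    using H' by (auto simp: continuous_extension_def)
  then have C': "composable H' = composable \<Gamma>"
    by (auto simp: composable_def digraph.truncate_def)
  have ci: "continuous_map T T (ginv H')"
    and cm: "continuous_map (subtopology (prod_topology T T) (composable \<Gamma>)) T (\<lambda>(x, y). gmult H' x y)"
    using cont by (auto simp: continuous_operations_def C')
  have "ginv H' x = completion_inv x" if x: "x \<in> carrier \<Gamma>" for x
  proof (rule cl_eqI)
    show i: "ginv H' x \<in> carrier \<Gamma>"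
      using continuous_map_image_subset_topspace[OF ci] x topspace by auto
    show "completion_inv x \<in> carrier \<Gamma>" by (rule completion_inv(1)[OF x])
    fix \<rho> assume \<rho>: "\<rho> \<in> P"
    \<comment> \<open>The first set keeps the given inverse close by its continuity; the second
      makes \<open>g\<close> an approximant of \<open>x\<close>, which controls
      \<open>completion_inv\<close>.\<close>
    let ?W = "{y \<in> topspace T. ginv H' y \<in> cl \<rho> `` {ginv H' x}} \<inter> cl \<rho> `` {x}"
    have "openin T ?W"
      by (intro openin_Int openin_continuous_map_preimage[OF ci] openin_cl[OF \<rho>])
    moreover have "x \<in> ?W"
      using x i topspace equiv_reflD[OF equiv_cl[OF \<rho>]] by auto
    ultimately obtain g where g: "g \<in> carrier G" "j g \<in> ?W" by (rule dense)
    then have "(ginv H' x, j (ginv G g)) \<in> cl \<rho>" using inv' by auto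
    moreover have "(completion_inv x, j (ginv G g)) \<in> cl \<rho>"
      using completion_inv(2)[OF x \<rho> g(1)] g(2) by auto
    ultimately show "\<exists>z. (ginv H' x, z) \<in> cl \<rho> \<and> (completion_inv x, z) \<in> cl \<rho>" by blast
  qed
  moreover have "gmult H' x y = completion_mult x y" if c: "(x, y) \<in> composable \<Gamma>" for x y
  proof (rule cl_eqI)
    let ?C = "subtopology (prod_topology T T) (composable \<Gamma>)"
    have car: "x \<in> carrier \<Gamma>" "y \<in> carrier \<Gamma>" using c by (auto simp: composable_def)
    have C: "topspace ?C = composable \<Gamma>"
      using topspace by (auto simp: composable_def)
    show m: "gmult H' x y \<in> carrier \<Gamma>"
      using continuous_map_image_subset_topspace[OF cm] c unfolding C topspace by auto
    show "completion_mult x y \<in> carrier \<Gamma>" by (rule completion_mult(1)[OF c])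
    fix \<rho> assume \<rho>: "\<rho> \<in> P"
    have "openin ?C {p \<in> topspace ?C. (case p of (x, y) \<Rightarrow> gmult H' x y) \<in> cl \<rho> `` {gmult H' x y}}"
      by (rule openin_continuous_map_preimage[OF cm openin_cl[OF \<rho>]])
    then obtain W where W: "openin (prod_topology T T) W"
      "{p \<in> topspace ?C. (case p of (x, y) \<Rightarrow> gmult H' x y) \<in> cl \<rho> `` {gmult H' x y}} = W \<inter> composable \<Gamma>"
      unfolding openin_subtopology by blast
    have W': "(a, b) \<in> W \<longleftrightarrow> (gmult H' x y, gmult H' a b) \<in> cl \<rho>" if "(a, b) \<in> composable \<Gamma>" for a b
    proof -
      have "(a, b) \<in> W \<inter> composable \<Gamma> \<longleftrightarrow> (gmult H' x y, gmult H' a b) \<in> cl \<rho>"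
        unfolding W(2)[symmetric] C using that by auto
      then show ?thesis using that by simp
    qed
    have "(x, y) \<in> W"
      using W'[OF c] m equiv_reflD[OF equiv_cl[OF \<rho>]] by simp
    then obtain A B where AB: "openin T A" "openin T B" "x \<in> A" "y \<in> B" "A \<times> B \<subseteq> W"
      using W(1) unfolding openin_prod_topology_alt by metis
    \<comment> \<open>Membership in \<open>A\<close> controls the given product by continuity,
      membership in the class of \<open>x\<close> makes \<open>composable_approx\<close> and
      \<open>completion_mult\<close> applicable.\<close>
    obtain g where g: "g \<in> carrier G" "j g \<in> A \<inter> cl \<rho> `` {x}"
      using dense[of "A \<inter> cl \<rho> `` {x}" x] AB(1,3) openin_cl[OF \<rho>]
        equiv_reflD[OF equiv_cl[OF \<rho>] car(1)] by blast
    obtain h where h: "h \<in> carrier G" "j h \<in> B \<inter> cl \<rho> `` {y}"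
      using dense[of "B \<inter> cl \<rho> `` {y}" y] AB(2,4) openin_cl[OF \<rho>]
        equiv_reflD[OF equiv_cl[OF \<rho>] car(2)] by blast
    have gx: "(x, j g) \<in> cl \<rho>" and hy: "(y, j h) \<in> cl \<rho>" using g h by auto
    have gh: "(g, h) \<in> composable G"
      by (rule composable_approx[OF c \<rho> g(1) gx h(1) hy])
    have "(gmult H' x y, j (gmult G g h)) \<in> cl \<rho>"
      using W'[of "j g" "j h"] composable_j[OF g(1) h(1)] gh AB(5) g h mult'[OF gh] by auto
    moreover have "(completion_mult x y, j (gmult G g h)) \<in> cl \<rho>"
      by (rule completion_mult(2)[OF c \<rho> g(1) h(1) gx hy])
    ultimately show "\<exists>z. (gmult H' x y, z) \<in> cl \<rho> \<and> (completion_mult x y, z) \<in> cl \<rho>" by blast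
  qed
  ultimately show ?thesis by (auto simp: same_operations_def)
qed

section \<open>Rigid cofinite congruences on the completion\<close>

text \<open>Every class of the closure contains some \<open>j g\<close> by density and depends only
  on the class of \<open>g\<close> modulo \<open>\<rho>\<close>, so the finitely many classes of
  \<open>\<rho>\<close> cover all of them.\<close>

lemma finite_quotient_cl:
  assumes \<rho>: "\<rho> \<in> P"
  shows "finite (carrier \<Gamma> // cl \<rho>)"
proof -
  have "carrier \<Gamma> // cl \<rho> \<subseteq> (\<lambda>C. cl \<rho> `` (j ` C)) ` (carrier G // \<rho>)"
  proof
    fix D assume "D \<in> carrier \<Gamma> // cl \<rho>"
    then obtain x where x: "x \<in> carrier \<Gamma>" "D = cl \<rho> `` {x}" by (rule quotientE)
    obtain g where g: "g \<in> carrier G" "(x, j g) \<in> cl \<rho>" by (rule cl_approx[OF \<rho> x(1)])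
    have "D = cl \<rho> `` {j g}"
      using x(2) equiv_class_eq[OF equiv_cl[OF \<rho>] g(2)] by simp
    then have same: "cl \<rho> `` {j h} = D" if "h \<in> \<rho> `` {g}" for h
      using that cl_j[OF \<rho> g(1)] equiv_type[OF P_D(5)[OF \<rho>]]
        equiv_class_eq[OF equiv_cl[OF \<rho>], of "j g" "j h"] by auto
    have "cl \<rho> `` (j ` (\<rho> `` {g})) = (\<Union>h\<in>\<rho> `` {g}. cl \<rho> `` {j h})" by auto
    also have "\<dots> = (\<Union>h\<in>\<rho> `` {g}. D)"
      by (rule SUP_cong[OF refl same])
    also have "\<dots> = D"
      using equiv_reflD[OF P_D(5)[OF \<rho>] g(1)] by auto
    finally have "D = cl \<rho> `` (j ` (\<rho> `` {g}))" by (rule sym)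
    then show "D \<in> (\<lambda>C. cl \<rho> `` (j ` C)) ` (carrier G // \<rho>)"
      by (rule image_eqI) (rule quotientI[OF g(1)])
  qed
  then show ?thesis
    using P_D(3)[OF \<rho>] by (meson finite_imageI finite_subset)
qed

lemma rigid_cl:
  assumes \<rho>: "\<rho> \<in> P"
  shows "rigid completion_groupoid (cl \<rho>)"
proof -
  have "u = v" if "(u, v) \<in> cl \<rho>" "u \<in> verts \<Gamma>" "v \<in> verts \<Gamma>" for u v
    using cl_src_tgt(1)[OF \<rho> that(1)] \<Gamma>_digraph(4) that by simp
  then show ?thesis
    using \<Gamma>_verts_carrier equiv_reflD[OF equiv_cl[OF \<rho>]] by (auto simp: rigid_def)
qed

text \<open>With open classes, \<open>R\<close> is both open and closed in the square, and such a
  set is the closure of its trace on a dense subset. Concretely, approximants can be chosen inside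
  the classes of \<open>x\<close> and \<open>y\<close>.\<close>

lemma cl_restriction:
  assumes eq: "equiv (carrier \<Gamma>) R" and ent: "entourage \<V> R"
  shows "cl {(g, h) \<in> carrier G \<times> carrier G. (j g, j h) \<in> R} = R" (is "cl ?\<rho> = R")
proof -
  have "openin T (R `` {x})" for x
    using openin_entourage_class[OF compatible _ ent] eq topspace by simp
  note op = this
  have "(x, y) \<in> cl ?\<rho> \<longleftrightarrow> (x, y) \<in> R" for x y
  proof
    assume xy: "(x, y) \<in> cl ?\<rho>"
    then have car: "x \<in> carrier \<Gamma>" "y \<in> carrier \<Gamma>" by (auto simp: in_cl)
    then have "x \<in> R `` {x}" "y \<in> R `` {y}" using equiv_reflD[OF eq] by auto
    then obtain g h where "(g, h) \<in> ?\<rho>" "j g \<in> R `` {x}" "j h \<in> R `` {y}"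
      using in_clE[OF xy op op] by blast
    then show "(x, y) \<in> R"
      using equiv_symD[OF eq] equiv_transD[OF eq] by blast
  next
    assume xy: "(x, y) \<in> R"
    then have car: "x \<in> carrier \<Gamma>" "y \<in> carrier \<Gamma>" using equiv_type[OF eq] by auto
    have "\<exists>g h. (g, h) \<in> ?\<rho> \<and> j g \<in> A \<and> j h \<in> B"
      if o: "openin T A" "openin T B" "x \<in> A" "y \<in> B" for A B
    proof -
      obtain g where g: "g \<in> carrier G" "j g \<in> A \<inter> R `` {x}"
        using dense[of "A \<inter> R `` {x}" x] o op equiv_reflD[OF eq car(1)] by blast
      obtain h where h: "h \<in> carrier G" "j h \<in> B \<inter> R `` {y}"
        using dense[of "B \<inter> R `` {y}" y] o op equiv_reflD[OF eq car(2)] by blast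
      have "(j g, j h) \<in> R"
        using g(2) h(2) xy equiv_symD[OF eq] equiv_transD[OF eq] by blast
      then show ?thesis using g h by blast
    qed
    then show "(x, y) \<in> cl ?\<rho>" using car by (simp add: in_cl)
  qed
  then show ?thesis by auto
qed

text \<open>Everything pulls back along \<open>j\<close>, which respects all operations. Classes of
  the restriction are traces of classes of \<open>R\<close>, whence finite index, and the uniformity
  of \<open>G\<close> is induced by \<open>\<V>\<close>, whence an entourage.\<close>

lemma restriction_in_P:
  assumes R: "R \<in> rigid_cofinite_congruences completion_groupoid \<V>"
  shows "{(g, h) \<in> carrier G \<times> carrier G. (j g, j h) \<in> R} \<in> P" (is "?\<rho> \<in> P")
proof -
  have cong: "congruence completion_groupoid R" and rig: "rigid completion_groupoid R"
    and fin: "finite (carrier \<Gamma> // R)" and ent: "entourage \<V> R"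
    using R by (auto simp: rigid_cofinite_congruences_def cofinite_congruence_def)
  have eq: "equiv (carrier \<Gamma>) R" using congruenceD(1)[OF cong] by simp
  have eq\<rho>: "equiv (carrier G) ?\<rho>"
  proof (rule equivI)
    show "refl_on (carrier G) ?\<rho>"
      using equiv_reflD[OF eq] j_carrier by (auto intro!: refl_onI)
    show "sym ?\<rho>" using equiv_symD[OF eq] by (auto intro!: symI)
    show "trans ?\<rho>" using equiv_transD[OF eq] by (auto intro!: transI)
  qed auto
  have "congruence G ?\<rho>"
    unfolding congruence_iff
  proof (intro conjI allI impI)
    show "equiv (carrier G) ?\<rho>" by (rule eq\<rho>)
    fix g h assume gh: "(g, h) \<in> ?\<rho>"
    then have c: "g \<in> carrier G" "h \<in> carrier G" and r: "(j g, j h) \<in> R" by auto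
    show "(src G g, src G h) \<in> ?\<rho>" "(tgt G g, tgt G h) \<in> ?\<rho>"
      using congruenceD(2,3)[OF cong r] c gr(2,3) verts_carrier by (auto simp: j_src j_tgt)
    show "(ginv G g, ginv G h) \<in> ?\<rho>"
      using congruenceD(4)[OF cong r] c gr(4) by (simp add: completion_inv_j)
  next
    fix g g' h h' assume gg: "(g, g') \<in> ?\<rho>" and hh: "(h, h') \<in> ?\<rho>"
      and c: "(g, h) \<in> composable G" "(g', h') \<in> composable G"
    have "(j g, j h) \<in> composable \<Gamma>" "(j g', j h') \<in> composable \<Gamma>"
      using gg hh c composable_j by auto
    then have "(completion_mult (j g) (j h), completion_mult (j g') (j h')) \<in> R"
      using congruenceD(5)[OF cong, of "j g" "j g'" "j h" "j h'"] gg hh by simp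
    then show "(gmult G g h, gmult G g' h') \<in> ?\<rho>"
      using c gr(7) by (simp add: completion_mult_j)
  qed
  moreover have "finite (carrier G // ?\<rho>)"
  proof -
    have "carrier G // ?\<rho> \<subseteq> (\<lambda>D. {g \<in> carrier G. j g \<in> D}) ` (carrier \<Gamma> // R)"
    proof
      fix C assume "C \<in> carrier G // ?\<rho>"
      then obtain g where g: "g \<in> carrier G" "C = ?\<rho> `` {g}" by (rule quotientE)
      then have "C = {h \<in> carrier G. j h \<in> R `` {j g}}" by auto
      then show "C \<in> (\<lambda>D. {g \<in> carrier G. j g \<in> D}) ` (carrier \<Gamma> // R)"
        using quotientI[OF j_carrier[OF g(1)]] by blast
    qed
    then show ?thesis using fin by (meson finite_imageI finite_subset)
  qed
  moreover have "entourage \<U> ?\<rho>"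
    unfolding entourage_iff using ent by (intro exI[of _ R]) auto
  moreover have "rigid G ?\<rho>"
  proof -
    \<comment> \<open>Rigidity of \<open>R\<close> applies since \<open>j\<close> maps vertices to
      vertices, and injectivity of \<open>j\<close> returns the equality to
      \<open>G\<close>.\<close>
    have "u = v" if "u \<in> verts G" "v \<in> verts G" "(j u, j v) \<in> R" for u v
      using rigid_verts_eq[OF rig, of "j u" "j v"] that verts_completion j_eq_iff verts_carrier
      by auto
    then show ?thesis
      using verts_carrier j_carrier equiv_reflD[OF eq] by (auto simp: rigid_def)
  qed
  ultimately show ?thesis
    by (simp add: rigid_cofinite_congruences_def cofinite_congruence_def)
qed

lemma rigid_cofinite_congruences_completion:
  "rigid_cofinite_congruences completion_groupoid \<V> = cl ` P"
proof
  show "cl ` P \<subseteq> rigid_cofinite_congruences completion_groupoid \<V>"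
    using congruence_cl rigid_cl finite_quotient_cl entourage_cl
    by (auto simp: rigid_cofinite_congruences_def cofinite_congruence_def)
  show "rigid_cofinite_congruences completion_groupoid \<V> \<subseteq> cl ` P"
  proof
    fix R assume R: "R \<in> rigid_cofinite_congruences completion_groupoid \<V>"
    have "equiv (carrier \<Gamma>) R" "entourage \<V> R"
      using R by (auto simp: rigid_cofinite_congruences_def cofinite_congruence_def
          dest: congruenceD(1))
    then have "R = cl {(g, h) \<in> carrier G \<times> carrier G. (j g, j h) \<in> R}"
      using cl_restriction by simp
    then show "R \<in> cl ` P"
      using restriction_in_P[OF R] by (rule image_eqI)
  qed
qed

lemma topological_groupoid_completion: "topological_groupoid completion_groupoid T"
proof -
  have "topological_digraph completion_groupoid T"
    using top is_groupoid_completion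
    by (simp add: topological_digraph_def is_groupoid_def)
  then show ?thesis
    using is_groupoid_completion continuous_operations_completion
    by (simp add: topological_groupoid_def)
qed

text \<open>The congruences on the completion have the index type that
  \<open>profinite_groupoid\<close> prescribes. Taking all rigid cofinite ones gives closure under
  intersection at once, without comparing the closure of an intersection with the intersection of
  closures; their description as closures supplies openness of classes and separation of
  points.\<close>

lemma profinite_completion: "profinite_groupoid completion_groupoid T"
proof (rule profinite_groupoidI[OF topological_groupoid_completion compact])
  let ?\<R> = "rigid_cofinite_congruences completion_groupoid \<V>"
  note \<R> = rigid_cofinite_congruences_completion
  show "?\<R> \<noteq> {}" using P_nonempty by (simp add: \<R>)
  show "congruence completion_groupoid R" "rigid completion_groupoid R"
    "finite (carrier completion_groupoid // R)" if "R \<in> ?\<R>" for R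
    using that by (auto simp: rigid_cofinite_congruences_def cofinite_congruence_def)
  show "openin T (R `` {x})" if "R \<in> ?\<R>" for R x
    using that openin_cl by (auto simp: \<R>)
  show "R \<inter> S \<in> ?\<R>" if "R \<in> ?\<R>" "S \<in> ?\<R>" for R S
    using that by (rule rigid_cofinite_congruences_Int)
  show "x = y" if "x \<in> carrier completion_groupoid" "y \<in> carrier completion_groupoid"
    "\<And>R. R \<in> ?\<R> \<Longrightarrow> (x, y) \<in> R" for x y
    using that by (intro cl_separates) (auto simp: \<R>)
qed

end

theorem theorem6p15:
  fixes G :: "'a groupoid" and \<U> :: "('a \<times> 'a) filter"
    and \<Gamma> :: "'b digraph" and T :: "'b topology" and \<V> :: "('b \<times> 'b) filter"
    and j :: "'a \<Rightarrow> 'b"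
  assumes "cofinite_groupoid G \<U>"
    and "finite (verts G)"
    and "is_completion G \<U> \<Gamma> T \<V> j"
  shows "\<exists>H :: 'b groupoid.
    continuous_extension G \<Gamma> T j H \<and>
    (\<forall>H'. continuous_extension G \<Gamma> T j H' \<longrightarrow> same_operations H H') \<and>
    profinite_groupoid H T \<and>
    verts H = j ` verts G \<and>
    rigid_cofinite_congruences H \<V> =
      {prod_topology T T closure_of (map_prod j j ` \<rho>) | \<rho>. \<rho> \<in> rigid_cofinite_congruences G \<U>}"
proof -
  interpret finite_vertex_completion G \<U> \<Gamma> T \<V> j
    using assms by unfold_locales
  have "continuous_extension G \<Gamma> T j completion_groupoid"
    using continuous_operations_completion completion_inv_j completion_mult_j
    by (auto simp: continuous_extension_def)
  moreover have "rigid_cofinite_congruences completion_groupoid \<V> =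
      {prod_topology T T closure_of (map_prod j j ` \<rho>) | \<rho>. \<rho> \<in> P}"
    unfolding rigid_cofinite_congruences_completion cl_def by auto
  ultimately show ?thesis
    using completion_unique profinite_completion verts_completion
    by (intro exI[of _ completion_groupoid]) simp
qed

end
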